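(* Let $\Omega\subset\mathbb{C}_\infty$ be an open set with $0\in\Omega$, and let $T$ be the Taylor shift on $A^p(\Omega)$. Let $\sigma(T)$ and $\sigma_0(T)$ denote the spectrum and the point spectrum (set of eigenvalues) of $T$. Then: 1. $(\Omega^* )^\circ\subset\sigma_0(T)$ and $\overline{(\Omega^* )^\circ}\subset\sigma(T)\subset\Omega^*$ for all $1\le p<\infty$. 2. $\sigma_0(T)=\sigma(T)=\Omega^*$ for $1\le p<2$.
   Context: $\mathbb{C}_\infty$ is the Riemann sphere. For $A\subset\mathbb{C}_\infty$, $A^*:=\{1/w: w\in\mathbb{C}_\infty\setminus A\}$ (with $1/0=\infty$, $1/\infty=0$); for $\Omega$ open with $0\in\Omega$, $\Omega^*$ is compact in $\mathbb{C}$. $A^\circ$ denotes the interior. $H(\Omega)$ is the space of functions holomorphic in $\Omega$ (and vanishing at $\infty$ if $\infty\in\Omega$). $m_2$ is the normalized surface measure on the sphere $\mathbb{C}_\infty$; for $1\le p<\infty$, $A^p(\Omega)$ is the Banach space of all $f\in H(\Omega)$ with $\|f\|_p=(\int_\Omega|f|^p\,dm_2)^{1/p}<\infty$. The Taylor shift $T$ is the continuous operator on $A^p(\Omega)$ given by $(Tf)(z)=(f(z)-f(0))/z$ for $z\neq0$, $(Tf)(0)=f'(0)$ (value $0$ at $\infty$ if $\infty\in\Omega$). *)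

theory Defs
  imports "HOL-Analysis.Analysis"
begin

(* Points of the sphere have type complex option; None is the point at infinity. *)

abbreviation riemann_sphere :: "complex option topology" where
  "riemann_sphere \<equiv> Alexandroff_compactification (euclidean :: complex topology)"

fun sphere_inverse :: "complex option \<Rightarrow> complex option" where
  "sphere_inverse None = Some 0"
| "sphere_inverse (Some z) = (if z = 0 then None else Some (1 / z))"

definition sphere_star :: "complex option set \<Rightarrow> complex option set" where
  "sphere_star A = {sphere_inverse w | w. w \<notin> A}"

(* The set sphere_star A regarded as a subset of the plane; by image_Some_star nothing is
   lost when 0 belongs to A. *)
definition star :: "complex option set \<Rightarrow> complex set" where
  "star A = {z. Some z \<in> sphere_star A}"

lemma image_Some_star:
  assumes "Some 0 \<in> A"
  shows "Some ` star A = sphere_star A"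
proof -
  have "sphere_inverse w \<noteq> None" if "w \<notin> A" for w
    using assms that by (cases w) auto
  then have "None \<notin> sphere_star A"
    by (force simp: sphere_star_def)
  then have "x \<in> Some ` star A" if "x \<in> sphere_star A" for x
    using that by (cases x) (auto simp: star_def)
  then show ?thesis
    by (auto simp: star_def)
qed

(* Inverse stereographic projection from the plane onto the unit sphere in three-space has area
   element 4 / (1 + |z|^2)^2; division by the total area 4 pi gives the density below. *)
definition sphere_measure :: "complex option measure" where
  "sphere_measure =
     distr (density lborel (\<lambda>z::complex. ennreal (1 / (pi * (1 + (cmod z)\<^sup>2)\<^sup>2))))
       (sigma UNIV {U. openin riemann_sphere U}) Some"

(* The push-forward is along a measurable map, so it is not a degenerate distr. *)
lemma measurable_Some_sphere:
  "Some \<in> measurable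
     (density lborel (\<lambda>z::complex. ennreal (1 / (pi * (1 + (cmod z)\<^sup>2)\<^sup>2))))
     (sigma UNIV {U. openin riemann_sphere U})"
proof (rule measurable_measure_of)
  fix U :: "complex option set"
  assume "U \<in> {U. openin riemann_sphere U}"
  then have "open (Some -` U)"
    by (auto simp: openin_Alexandroff_compactification vimage_image_eq vimage_def image_iff
        Compl_eq[symmetric] open_closed simp del: open_openin)
  then show "Some -` U \<inter> space (density lborel
      (\<lambda>z::complex. ennreal (1 / (pi * (1 + (cmod z)\<^sup>2)\<^sup>2))))
    \<in> sets (density lborel (\<lambda>z::complex. ennreal (1 / (pi * (1 + (cmod z)\<^sup>2)\<^sup>2))))"
    by simp
qed auto

(* Functions on a subset of the sphere are represented by their extension by 0, so that equality
   of functions on the subset is equality in HOL.  Holomorphy is tested in the two charts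
   z and 1/z. *)
definition holo_space :: "complex option set \<Rightarrow> (complex option \<Rightarrow> complex) set" where
  "holo_space \<Omega> = {f.
     (\<forall>z. z \<notin> \<Omega> \<longrightarrow> f z = 0) \<and>
     (\<lambda>z. f (Some z)) holomorphic_on {z. Some z \<in> \<Omega>} \<and>
     (\<lambda>w. f (sphere_inverse (Some w))) holomorphic_on {w. sphere_inverse (Some w) \<in> \<Omega>} \<and>
     (None \<in> \<Omega> \<longrightarrow> f None = 0)}"

definition bergman_space ::
    "real \<Rightarrow> complex option set \<Rightarrow> (complex option \<Rightarrow> complex) set" where
  "bergman_space p \<Omega> = {f \<in> holo_space \<Omega>.
     set_integrable sphere_measure \<Omega> (\<lambda>z. cmod (f z) powr p)}"

definition bergman_norm ::
    "real \<Rightarrow> complex option set \<Rightarrow> (complex option \<Rightarrow> complex) \<Rightarrow> real" where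
  "bergman_norm p \<Omega> f = (LINT z:\<Omega>|sphere_measure. cmod (f z) powr p) powr (1 / p)"

definition taylor_shift ::
    "complex option set \<Rightarrow> (complex option \<Rightarrow> complex) \<Rightarrow> complex option \<Rightarrow> complex" where
  "taylor_shift \<Omega> f z =
     (if z \<notin> \<Omega> then 0
      else case z of
        None \<Rightarrow> 0
      | Some w \<Rightarrow> if w = 0 then deriv (\<lambda>u. f (Some u)) 0
                  else (f (Some w) - f (Some 0)) / w)"

(* Bounded operators on a normed space given by a carrier X of complex functions and a norm N,
   since a space depending on the set and on p cannot be a type. *)
definition bounded_operator_on ::
    "('a \<Rightarrow> complex) set \<Rightarrow> (('a \<Rightarrow> complex) \<Rightarrow> real) \<Rightarrow>
      (('a \<Rightarrow> complex) \<Rightarrow> ('a \<Rightarrow> complex)) \<Rightarrow> bool" where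
  "bounded_operator_on X N S \<longleftrightarrow>
     (\<forall>f\<in>X. S f \<in> X) \<and>
     (\<forall>f\<in>X. \<forall>g\<in>X. S (\<lambda>z. f z + g z) = (\<lambda>z. S f z + S g z)) \<and>
     (\<forall>c. \<forall>f\<in>X. S (\<lambda>z. c * f z) = (\<lambda>z. c * S f z)) \<and>
     (\<exists>C. \<forall>f\<in>X. N (S f) \<le> C * N f)"

definition spectrum_on ::
    "('a \<Rightarrow> complex) set \<Rightarrow> (('a \<Rightarrow> complex) \<Rightarrow> real) \<Rightarrow>
      (('a \<Rightarrow> complex) \<Rightarrow> ('a \<Rightarrow> complex)) \<Rightarrow> complex set" where
  "spectrum_on X N T = {l. \<not> (\<exists>S. bounded_operator_on X N S \<and>
     (\<forall>f\<in>X. S (\<lambda>z. T f z - l * f z) = f) \<and>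
     (\<forall>f\<in>X. (\<lambda>z. T (S f) z - l * S f z) = f))}"

definition point_spectrum_on ::
    "('a \<Rightarrow> complex) set \<Rightarrow> (('a \<Rightarrow> complex) \<Rightarrow> ('a \<Rightarrow> complex)) \<Rightarrow> complex set" where
  "point_spectrum_on X T = {l. \<exists>f\<in>X. f \<noteq> (\<lambda>z. 0) \<and> T f = (\<lambda>z. l * f z)}"

abbreviation taylor_spectrum :: "real \<Rightarrow> complex option set \<Rightarrow> complex set" where
  "taylor_spectrum p \<Omega> \<equiv>
     spectrum_on (bergman_space p \<Omega>) (bergman_norm p \<Omega>) (taylor_shift \<Omega>)"

abbreviation taylor_point_spectrum :: "real \<Rightarrow> complex option set \<Rightarrow> complex set" where
  "taylor_point_spectrum p \<Omega> \<equiv> point_spectrum_on (bergman_space p \<Omega>) (taylor_shift \<Omega>)"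

end

(* With u = 1/z as coordinate, the set of all l outside star \<Omega> is the copy of \<Omega> in the chart at
   infinity. There T f - l f = g reads (u - l) f(1/u) = g(1/u) + f(0) u, which has exactly one
   solution that is regular at u = l; it is bounded by g by the maximum principle on a small circle
   around l and the boundedness of point evaluations on the Bergman space. For l in star \<Omega> the
   function 1 / (1 - l z) is the only candidate for an eigenfunction. It is bounded on \<Omega> if l is
   interior to star \<Omega>, and for p < 2 it is p-integrable in any case. At points of the closure of the
   interior these eigenfunctions are approximate eigenvectors. *)
theory Submission
  imports Defs "HOL-Complex_Analysis.Complex_Analysis"
begin


section \<open>Measure on the sphere\<close>

text \<open>The unknown in the resolvent equation is the single number f(0). If l = 0, the critical
  point of the chart is infinity itself: the numerator vanishes there for every choice of f(0), so
  regularity says nothing, and the value is fixed by the vanishing of f at infinity. This is why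
  derivatives in the chart enter next to point values. The inverse operator R is written down
  explicitly, and its boundedness is reduced to a pointwise estimate |R g| <= A |g| + B ||g||. Away
  from l, division by u - l costs a multiple of |g| plus a constant; near l only the values of g on
  a circle count. The constant term is p-integrable because the sphere has finite measure. The same
  explicit style is used elsewhere: point evaluations are bounded through a weighted maximum instead
  of subharmonicity of |f|^p, and limits of eigenvalues are treated by testing a hypothetical
  inverse on eigenfunctions instead of by closedness of the spectrum. The threshold p = 2 is the
  real dimension of the plane: a simple pole is locally p-integrable just below it.\<close>

lemma space_sphere_measure [simp]: "space sphere_measure = UNIV"
  by (simp add: sphere_measure_def space_measure_of_conv)

lemma openin_sphere_sets:
  assumes "openin riemann_sphere U"
  shows "U \<in> sets sphere_measure"
  using assms by (auto simp: sphere_measure_def)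

lemma open_planar_part:
  assumes "openin riemann_sphere \<Omega>"
  shows "open {z. Some z \<in> \<Omega>}"
  using assms
  by (auto simp: openin_Alexandroff_compactification image_iff Compl_eq[symmetric])

text \<open>The plane is open in the sphere, so \<open>{None}\<close> is a measurable set and the
  value at infinity may be arbitrary. Elsewhere \<open>d\<close> is a measurable inverse of
  \<open>Some\<close>; its value at \<open>None\<close> is a dummy.\<close>

lemma borel_measurable_sphere:
  fixes h :: "complex option \<Rightarrow> 'b::topological_space"
  assumes "(\<lambda>z. h (Some z)) \<in> borel_measurable borel"
  shows "h \<in> borel_measurable sphere_measure"
proof -
  define d :: "complex option \<Rightarrow> complex" where "d x = (case x of None \<Rightarrow> 0 | Some z \<Rightarrow> z)" for x
  have Some_sets: "Some ` U \<in> sets sphere_measure" if "open U" for U :: "complex set"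
    using that by (intro openin_sphere_sets) simp
  have "{None} = space sphere_measure - (Some ` UNIV :: complex option set)"
    by (auto simp: image_iff)
  then have None_sets: "{None} \<in> sets sphere_measure"
    using Some_sets[of UNIV] by (metis open_UNIV sets.compl_sets)
  have "d \<in> borel_measurable sphere_measure"
  proof (rule borel_measurableI)
    fix U :: "complex set" assume "open U"
    have "d -` U \<inter> space sphere_measure = Some ` U \<union> (if 0 \<in> U then {None} else {})"
      by (auto simp: d_def split: option.splits)
    then show "d -` U \<inter> space sphere_measure \<in> sets sphere_measure"
      using Some_sets[OF \<open>open U\<close>] None_sets by (simp only: sets.Un sets.empty_sets split: if_split) blast
  qed
  moreover have "h = (\<lambda>x. if x \<in> {None} then h None else h (Some (d x)))"
    by (auto simp: d_def split: option.splits)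
  moreover have "(\<lambda>x. if x \<in> {None} then h None else h (Some (d x))) \<in> borel_measurable sphere_measure"
    if "d \<in> borel_measurable sphere_measure"
    using None_sets measurable_compose[OF that assms] by (intro measurable_If_set) auto
  ultimately show ?thesis
    by metis
qed

definition sphere_density :: "complex \<Rightarrow> real" where
  "sphere_density z = 1 / (pi * (1 + (cmod z)\<^sup>2)\<^sup>2)"

lemma sphere_density_pos: "0 < sphere_density z"
  unfolding sphere_density_def
  by (intro divide_pos_pos mult_pos_pos zero_less_power add_pos_nonneg) auto

lemma sphere_density_antimono:
  assumes "cmod z \<le> R"
  shows "1 / (pi * (1 + R\<^sup>2)\<^sup>2) \<le> sphere_density z"
  using assms unfolding sphere_density_def
  by (intro divide_left_mono mult_left_mono power_mono mult_pos_pos add_left_mono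
      zero_less_power add_pos_nonneg) auto

lemma sphere_density_le_1: "sphere_density z \<le> 1"
proof -
  have "1 * 1 \<le> pi * (1 + (cmod z)\<^sup>2)\<^sup>2"
    using pi_gt3 by (intro mult_mono one_le_power) auto
  then show ?thesis by (simp add: sphere_density_def)
qed

lemma sphere_density_measurable [measurable]: "sphere_density \<in> borel_measurable borel"
  unfolding sphere_density_def by measurable

lemma nn_integral_sphere:
  assumes "h \<in> borel_measurable sphere_measure"
  shows "(\<integral>\<^sup>+x. h x \<partial>sphere_measure) = (\<integral>\<^sup>+z. ennreal (sphere_density z) * h (Some z) \<partial>lborel)"
proof -
  let ?N = "sigma UNIV {U. openin riemann_sphere U}"
  let ?D = "density lborel (\<lambda>z. ennreal (sphere_density z))"
  have S: "Some \<in> measurable ?D ?N"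
    using measurable_Some_sphere by (simp add: sphere_density_def)
  have eq: "sphere_measure = distr ?D ?N Some"
    by (simp add: sphere_measure_def sphere_density_def)
  have h: "h \<in> borel_measurable ?N"
    using assms by (simp add: eq measurable_distr_eq1)
  have h': "(\<lambda>z. h (Some z)) \<in> borel_measurable ?D"
    using measurable_compose[OF S h] .
  have "h \<in> borel_measurable (distr ?D ?N Some)"
    using h by simp
  with h' show ?thesis
    unfolding eq by (simp add: nn_integral_distr[OF S] nn_integral_density)
qed

text \<open>Stands in for polar coordinates: a dyadic shell is enclosed in a ball, of area pi r^2.
  Growing radii serve the behaviour at infinity, shrinking radii a singularity at
  \<open>a\<close>.\<close>

lemma nn_integral_dominated_balls_finite:
  fixes f :: "complex \<Rightarrow> ennreal" and c r :: "nat \<Rightarrow> real"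
  assumes cover: "\<And>z. f z \<noteq> 0 \<Longrightarrow> \<exists>k. z \<in> ball a (r k) \<and> f z \<le> ennreal (c k)"
    and c: "\<And>k. 0 \<le> c k" and r: "\<And>k. 0 \<le> r k"
    and sm: "summable (\<lambda>k. c k * (r k)\<^sup>2)"
  shows "(\<integral>\<^sup>+z. f z \<partial>lborel) < \<infinity>"
proof -
  have "f z \<le> (\<Sum>k. ennreal (c k) * indicator (ball a (r k)) z)" for z
  proof (cases "f z = 0")
    case False
    then obtain k where k: "z \<in> ball a (r k)" "f z \<le> ennreal (c k)"
      using cover by blast
    have "f z \<le> (\<Sum>j\<in>{k}. ennreal (c j) * indicator (ball a (r j)) z)"
      using k by simp
    also have "\<dots> \<le> (\<Sum>k. ennreal (c k) * indicator (ball a (r k)) z)"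
      by (rule sum_le_suminf) auto
    finally show ?thesis .
  qed simp
  then have "(\<integral>\<^sup>+z. f z \<partial>lborel)
      \<le> (\<integral>\<^sup>+z. (\<Sum>k. ennreal (c k) * indicator (ball a (r k)) z) \<partial>lborel)"
    by (intro nn_integral_mono)
  also have "\<dots> = (\<Sum>k. ennreal (c k) * emeasure lborel (ball a (r k)))"
    by (subst nn_integral_suminf)
      (auto simp: nn_integral_cmult_indicator intro!: borel_measurable_times_ennreal borel_measurable_indicator)
  also have "\<dots> = (\<Sum>k. ennreal (pi * (c k * (r k)\<^sup>2)))"
    using c r by (intro suminf_cong) (simp add: emeasure_ball unit_ball_vol_2 ennreal_mult[symmetric] mult_ac)
  also have "\<dots> = ennreal (\<Sum>k. pi * (c k * (r k)\<^sup>2))"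
    using c r sm by (intro suminf_ennreal2) (auto intro: summable_mult)
  finally show ?thesis
    by (simp add: order_le_less_trans[OF _ ennreal_less_top])
qed

text \<open>On the shell 2^k <= |z| < 2^(k+1) the density is at most 16^(-k), while the enclosing
  ball has area 4 pi 4^k; the products decay like 4^(-k).\<close>

lemma nn_integral_sphere_density_finite: "(\<integral>\<^sup>+z. ennreal (sphere_density z) \<partial>lborel) < \<infinity>"
proof (rule nn_integral_dominated_balls_finite[where a = 0 and r = "\<lambda>k. 2 ^ (k + 1)"
      and c = "\<lambda>k. (1 / 16) ^ k"])
  fix z :: complex
  show "\<exists>k. z \<in> ball 0 (2 ^ (k + 1)) \<and> ennreal (sphere_density z) \<le> ennreal ((1 / 16) ^ k)"
  proof (cases "cmod z < 1")
    case True
    then show ?thesis using sphere_density_le_1 by (intro exI[of _ 0]) auto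
  next
    case False
    \<comment> \<open>The least such \<open>n\<close> is positive because |z| >= 1, and minimality
      gives the lower bound 2^k <= |z| for k = n - 1.\<close>
    define n where "n = (LEAST n. cmod z < 2 ^ n)"
    have ex: "\<exists>n. cmod z < 2 ^ n"
      using real_arch_pow[of 2 "cmod z"] by simp
    have n: "cmod z < 2 ^ n" unfolding n_def by (rule LeastI_ex[OF ex])
    have "n \<noteq> 0" using n False by (cases n) auto
    then obtain k where k: "n = Suc k" by (cases n) auto
    have lb: "2 ^ k \<le> cmod z"
      using not_less_Least[of k "\<lambda>n. cmod z < 2 ^ n"] k unfolding n_def by fastforce
    have "(16::real) ^ k = (2 ^ 4) ^ k" by simp
    also have "\<dots> = ((2 ^ k)\<^sup>2)\<^sup>2"
      by (metis power_mult mult.commute mult_2 numeral_Bit0)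
    also have "\<dots> \<le> (1 + (cmod z)\<^sup>2)\<^sup>2"
      using lb by (intro power_mono) (auto intro!: order_trans[OF power_mono[OF lb]])
    also have "\<dots> \<le> pi * (1 + (cmod z)\<^sup>2)\<^sup>2"
      using pi_gt3 by (simp add: mult_le_cancel_right1)
    finally have "sphere_density z \<le> (1 / 16) ^ k"
      by (simp add: sphere_density_def power_one_over frac_le)
    then show ?thesis using n k by (intro exI[of _ k]) (auto intro: ennreal_leI)
  qed
next
  have "(\<lambda>k. (1 / 16) ^ k * (2 ^ (k + 1))\<^sup>2) = (\<lambda>k. 4 * (1 / 4 :: real) ^ k)"
  proof
    fix k :: nat
    have "((2::real) ^ (k + 1))\<^sup>2 = 4 * 4 ^ k" 
    proof -
      have "((2::real) ^ (k + 1))\<^sup>2 = (2\<^sup>2) ^ (k + 1)" by (metis power_mult mult.commute)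
      then show ?thesis by simp
    qed
    moreover have "(1 / 16 :: real) ^ k * 4 ^ k = (1 / 4) ^ k"
      by (simp flip: power_mult_distrib)
    ultimately show "(1 / 16) ^ k * (2 ^ (k + 1))\<^sup>2 = 4 * (1 / 4 :: real) ^ k" by simp
  qed
  then show "summable (\<lambda>k. (1 / 16 :: real) ^ k * (2 ^ (k + 1))\<^sup>2)"
    by (simp add: summable_geometric)
qed auto

lemma finite_measure_sphere: "finite_measure sphere_measure"
proof
  have "emeasure sphere_measure (space sphere_measure) = (\<integral>\<^sup>+z. ennreal (sphere_density z) \<partial>lborel)"
    using nn_integral_sphere[of "\<lambda>_. 1"] by simp
  then show "emeasure sphere_measure (space sphere_measure) \<noteq> \<infinity>"
    using nn_integral_sphere_density_finite by simp
qed

text \<open>The density decreases with |z|, so its value at radius R is a lower bound on the ball;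
  the pi of the area cancels against the normalisation.\<close>

lemma measure_sphere_ball_ge:
  assumes "ball a r \<subseteq> cball 0 R" "0 \<le> r"
  shows "r\<^sup>2 / (1 + R\<^sup>2)\<^sup>2 \<le> measure sphere_measure (Some ` ball a r)"
proof -
  have sets: "Some ` ball a r \<in> sets sphere_measure"
    by (intro openin_sphere_sets) simp
  let ?k = "1 / (pi * (1 + R\<^sup>2)\<^sup>2)"
  have "ennreal (r\<^sup>2 / (1 + R\<^sup>2)\<^sup>2) = ennreal ?k * emeasure lborel (ball a r)"
    using assms(2) by (simp add: emeasure_ball unit_ball_vol_2 ennreal_mult[symmetric] field_simps)
  also have "\<dots> = (\<integral>\<^sup>+z. ennreal ?k * indicator (ball a r) z \<partial>lborel)"
    by (simp add: nn_integral_cmult_indicator)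
  also have "\<dots> \<le> (\<integral>\<^sup>+z. ennreal (sphere_density z) * indicator (Some ` ball a r) (Some z) \<partial>lborel)"
    using assms(1) by (intro nn_integral_mono) (auto simp: indicator_def image_iff subset_iff intro!: ennreal_leI sphere_density_antimono)
  also have "\<dots> = emeasure sphere_measure (Some ` ball a r)"
    using sets by (subst nn_integral_sphere[symmetric]) auto
  finally show ?thesis
    using finite_measure.emeasure_eq_measure[OF finite_measure_sphere] by simp
qed


section \<open>Point evaluations\<close>

text \<open>Maximising \<open>(r - \<bar>z - a\<bar>)\<^sup>2 \<bar>h z\<bar>\<^sup>p\<close> over the disc yields a point \<open>z\<^sub>0\<close> around which \<open>h\<close> is
  controlled by \<open>h z\<^sub>0\<close> at the scale of its distance to the boundary.\<close>

lemma holomorphic_large_on_disc: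
  fixes h :: "complex \<Rightarrow> complex"
  assumes hol: "h holomorphic_on U" and U: "open U" "cball a r \<subseteq> U" and r: "0 < r" and p: "1 \<le> p"
  obtains z0 d where "0 < d" "cball z0 d \<subseteq> cball a r"
    "\<And>z. z \<in> ball z0 (d / 16) \<Longrightarrow> cmod (h z0) / 2 \<le> cmod (h z)"
    "r\<^sup>2 * cmod (h a) powr p \<le> 4 * d\<^sup>2 * cmod (h z0) powr p"
proof (cases "h a = 0")
  case True
  then show ?thesis using that[of r a] r p by simp
next
  case False
  \<comment> \<open>The exponent 2/p makes the p-th power of \<open>\<phi>\<close> equal to
    (distance to the boundary)^2 |h|^p, which is comparable to the integral of |h|^p over a disc of
    that size. The maximum is useful only if positive, hence the separate case h a = 0.\<close>
  define \<phi> where "\<phi> z = (r - cmod (z - a)) powr (2 / p) * cmod (h z)" for z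
  have conth: "continuous_on U h"
    using hol by (rule holomorphic_on_imp_continuous_on)
  have "continuous_on (cball a r) \<phi>"
    unfolding \<phi>_def using p U(2)
    by (intro continuous_intros continuous_on_powr' continuous_on_subset[OF conth])
      (auto simp: dist_norm norm_minus_commute)
  then obtain z0 where z0: "z0 \<in> cball a r" and max: "\<And>z. z \<in> cball a r \<Longrightarrow> \<phi> z \<le> \<phi> z0"
    using continuous_attains_sup[OF compact_cball, of a r \<phi>] r by auto
  have "0 < \<phi> a" using False r by (simp add: \<phi>_def)
  then have "0 < \<phi> z0" using max[of a] r by simp
  then have nz: "r - cmod (z0 - a) \<noteq> 0" "h z0 \<noteq> 0" by (auto simp: \<phi>_def)
  \<comment> \<open>Half the distance from \<open>z0\<close> to the boundary: on
    \<open>cball z0 d\<close> the weight drops by a factor of at most 2^(2/p) <= 4, so maximality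
    bounds |h| there by 4 |h z0|.\<close>
  define d where "d = (r - cmod (z0 - a)) / 2"
  have d: "0 < d" using nz z0 by (simp add: d_def dist_norm norm_minus_commute)
  have sub: "cball z0 d \<subseteq> cball a r"
  proof
    fix z assume "z \<in> cball z0 d"
    then show "z \<in> cball a r"
      using d dist_triangle[of a z z0] by (simp add: d_def dist_norm norm_minus_commute)
  qed
  have pow2: "(x powr (2 / p)) powr p = x\<^sup>2" if "0 \<le> x" for x :: real
    using that p by (simp add: powr_powr powr_numeral)
  have bound4: "cmod (h z) \<le> 4 * cmod (h z0)" if z: "z \<in> cball z0 d" for z
  proof -
    have "d \<le> r - cmod (z - a)"
      using z norm_triangle_ineq[of "z - z0" "z0 - a"] by (simp add: d_def dist_norm norm_minus_commute field_simps)
    then have "d powr (2 / p) * cmod (h z) \<le> \<phi> z"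
      using d p unfolding \<phi>_def by (intro mult_right_mono powr_mono2) auto
    also have "\<dots> \<le> \<phi> z0" using max z sub by blast
    also have "\<dots> = d powr (2 / p) * (2 powr (2 / p) * cmod (h z0))"
    proof -
      have "r - cmod (z0 - a) = d * 2" by (simp add: d_def)
      then show ?thesis using d by (simp add: \<phi>_def powr_mult)
    qed
    finally have "cmod (h z) \<le> 2 powr (2 / p) * cmod (h z0)" using d by simp
    moreover have "2 powr (2 / p) \<le> 2 powr (2::real)"
      using p by (intro powr_mono) (auto simp: field_simps)
    then have "2 powr (2 / p) * cmod (h z0) \<le> 2 powr 2 * cmod (h z0)"
      by (intro mult_right_mono) auto
    ultimately show ?thesis by simp
  qed
  have holc: "h holomorphic_on cball z0 d"
    using hol sub U(2) by (meson holomorphic_on_subset order_trans)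
  have dbound: "cmod (deriv h z) \<le> 8 * cmod (h z0) / d" if z: "z \<in> cball z0 (d / 2)" for z
  proof -
    have sub2: "cball z (d / 2) \<subseteq> cball z0 d"
      using z by (intro cball_subset_cball_iff[THEN iffD2]) (auto simp: dist_commute)
    have "cmod ((deriv ^^ 1) h z) \<le> fact 1 * (4 * cmod (h z0)) / (d / 2) ^ 1"
    proof (rule Cauchy_inequality)
      show "h holomorphic_on ball z (d / 2)"
        using holc sub2 by (meson ball_subset_cball holomorphic_on_subset order_trans)
      show "continuous_on (cball z (d / 2)) h"
        using holc sub2 by (meson holomorphic_on_imp_continuous_on holomorphic_on_subset)
      show "cmod (h x) \<le> 4 * cmod (h z0)" if "cmod (z - x) = d / 2" for x
        using that sub2 by (intro bound4) (auto simp: dist_norm)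
    qed (use d in auto)
    then show ?thesis by (simp add: field_simps)
  qed
  \<comment> \<open>Cauchy's inequality on discs of radius d/2 bounds the derivative by 8 |h z0| /
    d, so over a distance d/16 the function changes by at most |h z0| / 2.\<close>
  have large: "cmod (h z0) / 2 \<le> cmod (h z)" if z: "z \<in> ball z0 (d / 16)" for z
  proof -
    have "cmod (h z - h z0) \<le> (8 * cmod (h z0) / d) * cmod (z - z0)"
    proof (rule field_differentiable_bound[OF convex_ball[of z0 "d/2"]])
      fix w assume w: "w \<in> ball z0 (d / 2)"
      have "h holomorphic_on ball z0 d" using holc by (meson ball_subset_cball holomorphic_on_subset)
      moreover have "w \<in> ball z0 d" using w d by simp
      ultimately show "(h has_field_derivative deriv h w) (at w within ball z0 (d / 2))"
        by (meson holomorphic_derivI open_ball has_field_derivative_at_within)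
      show "cmod (deriv h w) \<le> 8 * cmod (h z0) / d" using w by (intro dbound) auto
    qed (use z d in auto)
    also have "\<dots> \<le> (8 * cmod (h z0) / d) * (d / 16)"
      using z d by (intro mult_left_mono) (auto simp: dist_norm norm_minus_commute)
    also have "\<dots> = cmod (h z0) / 2" using d by simp
    finally have "cmod (h z - h z0) \<le> cmod (h z0) / 2" .
    then show ?thesis using norm_triangle_ineq2[of "h z0" "h z0 - h z"] by (simp add: norm_minus_commute)
  qed
  have "\<phi> a powr p \<le> \<phi> z0 powr p"
    using max[of a] r p by (intro powr_mono2) (auto simp: \<phi>_def)
  moreover have "\<phi> a powr p = r\<^sup>2 * cmod (h a) powr p"
    using r by (simp add: \<phi>_def powr_mult pow2)
  moreover have "\<phi> z0 powr p = 4 * d\<^sup>2 * cmod (h z0) powr p"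
    using z0 by (simp add: \<phi>_def powr_mult pow2 dist_norm norm_minus_commute)
      (simp add: d_def power_divide norm_minus_commute[of a z0])
  ultimately show ?thesis using that[of d z0] d sub large by simp
qed

section \<open>Norm estimates in the Bergman space\<close>

lemma holo_space_measurable:
  assumes "openin riemann_sphere \<Omega>" "f \<in> holo_space \<Omega>"
  shows "f \<in> borel_measurable sphere_measure"
proof (rule borel_measurable_sphere)
  let ?O = "{z. Some z \<in> \<Omega>}"
  have "continuous_on ?O (\<lambda>z. f (Some z))"
    using assms(2) by (auto simp: holo_space_def intro: holomorphic_on_imp_continuous_on)
  then have "(\<lambda>z. indicator ?O z *\<^sub>R f (Some z)) \<in> borel_measurable borel"
    using open_planar_part[OF assms(1)] by (intro borel_measurable_continuous_on_indicator) auto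
  moreover have "(\<lambda>z. indicator ?O z *\<^sub>R f (Some z)) = (\<lambda>z. f (Some z))"
    using assms(2) by (auto simp: holo_space_def indicator_def)
  ultimately show "(\<lambda>z. f (Some z)) \<in> borel_measurable borel" by simp
qed

lemma bergman_norm_nonneg: "0 \<le> bergman_norm p \<Omega> f"
  by (simp add: bergman_norm_def)

lemma set_integral_powr_nonneg:
  "0 \<le> (LINT x:\<Omega>|M. cmod (f x) powr p)"
  unfolding set_lebesgue_integral_def by (rule Bochner_Integration.integral_nonneg) simp

lemma bergman_norm_powr:
  assumes "1 \<le> p"
  shows "bergman_norm p \<Omega> f powr p = (LINT x:\<Omega>|sphere_measure. cmod (f x) powr p)"
  using assms by (simp add: bergman_norm_def powr_powr set_integral_powr_nonneg)

lemma bergman_norm_ge_on_ball: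
  assumes \<Omega>: "openin riemann_sphere \<Omega>" and f: "f \<in> bergman_space p \<Omega>" and p: "1 \<le> p"
    and sub: "Some ` ball z d \<subseteq> \<Omega>" "ball z d \<subseteq> cball 0 R" and d: "0 \<le> d"
    and m: "0 \<le> m" "\<And>w. w \<in> ball z d \<Longrightarrow> m \<le> cmod (f (Some w))"
  shows "m powr p * (d\<^sup>2 / (1 + R\<^sup>2)\<^sup>2) \<le> bergman_norm p \<Omega> f powr p"
proof -
  let ?B = "Some ` ball z d"
  interpret finite_measure sphere_measure by (rule finite_measure_sphere)
  have B: "?B \<in> sets sphere_measure" by (intro openin_sphere_sets) simp
  have "m powr p * (d\<^sup>2 / (1 + R\<^sup>2)\<^sup>2) \<le> m powr p * measure sphere_measure ?B"
    using measure_sphere_ball_ge[OF sub(2) d] by (intro mult_left_mono) auto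
  also have "\<dots> = (\<integral>x. indicator ?B x * m powr p \<partial>sphere_measure)"
    using B by simp
  also have "\<dots> \<le> (LINT x:\<Omega>|sphere_measure. cmod (f x) powr p)"
    unfolding set_lebesgue_integral_def
  proof (rule integral_mono)
    show "integrable sphere_measure (\<lambda>x. indicator ?B x * m powr p)"
      using B by (intro integrable_mult_left integrable_real_indicator) (auto simp: less_top[symmetric])
    show "integrable sphere_measure (\<lambda>x. indicat_real \<Omega> x *\<^sub>R cmod (f x) powr p)"
      using f by (simp add: bergman_space_def set_integrable_def)
    show "indicator ?B x * m powr p \<le> indicat_real \<Omega> x *\<^sub>R cmod (f x) powr p" for x
      using sub(1) m p by (auto simp: indicator_def intro!: powr_mono2)
  qed
  finally show ?thesis using bergman_norm_powr[OF p] by simp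
qed

text \<open>The small ball on which |f| is at least half its value at \<open>z0\<close> already
  contributes a multiple of d^2 |f z0|^p to the norm, and the choice of \<open>z0\<close> makes this
  dominate r^2 |f a|^p. Compactness of \<open>K\<close> gives one radius \<open>r\<close> and one
  bound \<open>R\<close> for all \<open>a\<close>.\<close>

lemma bergman_point_evaluation_bounded:
  assumes \<Omega>: "openin riemann_sphere \<Omega>" and p: "1 \<le> p" and K: "compact K" "Some ` K \<subseteq> \<Omega>"
  obtains C where "0 \<le> C"
    "\<And>f a. f \<in> bergman_space p \<Omega> \<Longrightarrow> a \<in> K \<Longrightarrow> cmod (f (Some a)) \<le> C * bergman_norm p \<Omega> f"
proof -
  let ?O = "{z. Some z \<in> \<Omega>}"
  obtain r where r: "0 < r" "(\<Union>a\<in>K. cball a r) \<subseteq> ?O"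
    using compact_subset_open_imp_cball_epsilon_subset[OF K(1) open_planar_part[OF \<Omega>]] K(2) by blast
  obtain R0 where R0: "\<And>a. a \<in> K \<Longrightarrow> cmod a \<le> R0"
    using compact_imp_bounded[OF K(1)] by (auto simp: bounded_iff)
  define R where "R = R0 + r"
  \<comment> \<open>2^p comes from halving |f z0|, 1024 = 4 * 16^2 from the factor 4 in the weighted
    maximum and the radius d/16, and (1 + R^2)^2 from the density.\<close>
  define C where "C = 2 powr p * 1024 * (1 + R\<^sup>2)\<^sup>2 / r\<^sup>2"
  have C0: "0 \<le> C" by (simp add: C_def)
  have "cmod (f (Some a)) \<le> C powr (1 / p) * bergman_norm p \<Omega> f"
    if f: "f \<in> bergman_space p \<Omega>" and a: "a \<in> K" for f a
  proof -
    let ?h = "\<lambda>z. f (Some z)" and ?N = "bergman_norm p \<Omega> f"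
    have hol: "?h holomorphic_on ?O" using f by (simp add: bergman_space_def holo_space_def)
    have sub: "cball a r \<subseteq> ?O" using r a by blast
    obtain z0 d where d: "0 < d" and zd: "cball z0 d \<subseteq> cball a r"
      and large: "\<And>z. z \<in> ball z0 (d / 16) \<Longrightarrow> cmod (?h z0) / 2 \<le> cmod (?h z)"
      and le: "r\<^sup>2 * cmod (?h a) powr p \<le> 4 * d\<^sup>2 * cmod (?h z0) powr p"
      by (rule holomorphic_large_on_disc[OF hol open_planar_part[OF \<Omega>] sub r(1) p]) blast
    have "ball z0 (d / 16) \<subseteq> cball z0 d" using d by auto
    then have b: "ball z0 (d / 16) \<subseteq> cball a r" using zd by blast
    have "cball a r \<subseteq> cball 0 R"
      using R0[OF a] r by (intro cball_subset_cball_iff[THEN iffD2]) (auto simp: R_def)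
    then have b2: "ball z0 (d / 16) \<subseteq> cball 0 R" using b by blast
    have "(cmod (?h z0) / 2) powr p * ((d / 16)\<^sup>2 / (1 + R\<^sup>2)\<^sup>2) \<le> ?N powr p"
      using b sub d large by (intro bergman_norm_ge_on_ball[OF \<Omega> f p _ b2]) auto
    moreover have "0 < 1 + R\<^sup>2" by (intro add_pos_nonneg) auto
    ultimately have "d\<^sup>2 * cmod (?h z0) powr p \<le> 2 powr p * 256 * (1 + R\<^sup>2)\<^sup>2 * ?N powr p"
      by (simp add: powr_divide field_simps power_divide)
    then have "r\<^sup>2 * cmod (?h a) powr p \<le> 2 powr p * 1024 * (1 + R\<^sup>2)\<^sup>2 * ?N powr p"
      using le by simp
    then have "cmod (?h a) powr p \<le> C * ?N powr p"
      using r by (simp add: C_def field_simps)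
    then have "(cmod (?h a) powr p) powr (1 / p) \<le> (C * ?N powr p) powr (1 / p)"
      using p by (intro powr_mono2) auto
    then show ?thesis
      using p C0 by (simp add: powr_powr powr_mult bergman_norm_nonneg)
  qed
  then show ?thesis using that[of "C powr (1 / p)"] by simp
qed

text \<open>Passes from pointwise bounds to norm bounds, using (s + t)^p <= 2^p (s^p + t^p) and the
  finiteness of the measure for the constant term. The constant depends only on \<open>A\<close>,
  \<open>B\<close>, \<open>p\<close> and the set, which is what makes an operator bounded.\<close>

lemma bergman_space_dominated:
  assumes \<Omega>: "openin riemann_sphere \<Omega>" and p: "1 \<le> p" and AB: "0 \<le> A" "0 \<le> B"
  obtains C where "\<And>f g. f \<in> holo_space \<Omega> \<Longrightarrow> g \<in> bergman_space p \<Omega> \<Longrightarrow>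
      (\<And>x. x \<in> \<Omega> \<Longrightarrow> cmod (f x) \<le> A * cmod (g x) + B * bergman_norm p \<Omega> g) \<Longrightarrow>
      f \<in> bergman_space p \<Omega> \<and> bergman_norm p \<Omega> f \<le> C * bergman_norm p \<Omega> g"
proof -
  interpret finite_measure sphere_measure by (rule finite_measure_sphere)
  have \<Omega>': "\<Omega> \<in> sets sphere_measure" using \<Omega> by (rule openin_sphere_sets)
  define C where "C = 2 powr p * (A powr p + B powr p * measure sphere_measure \<Omega>)"
  have C0: "0 \<le> C" by (simp add: C_def)
  have "f \<in> bergman_space p \<Omega> \<and> bergman_norm p \<Omega> f \<le> C powr (1 / p) * bergman_norm p \<Omega> g"
    if f: "f \<in> holo_space \<Omega>" and g: "g \<in> bergman_space p \<Omega>"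
      and le: "\<And>x. x \<in> \<Omega> \<Longrightarrow> cmod (f x) \<le> A * cmod (g x) + B * bergman_norm p \<Omega> g" for f g
  proof -
    let ?N = "bergman_norm p \<Omega> g"
    let ?F = "\<lambda>x. indicat_real \<Omega> x *\<^sub>R cmod (f x) powr p"
    let ?G = "\<lambda>x. indicat_real \<Omega> x *\<^sub>R cmod (g x) powr p"
    let ?H = "\<lambda>x. 2 powr p * (A powr p * ?G x + B powr p * ?N powr p * indicat_real \<Omega> x)"
    have intG: "integrable sphere_measure ?G"
      using g by (simp add: bergman_space_def set_integrable_def)
    have int\<Omega>: "integrable sphere_measure (indicat_real \<Omega>)"
      using \<Omega>' by (intro integrable_real_indicator) (auto simp: less_top[symmetric])
    have intH: "integrable sphere_measure ?H"
      by (intro integrable_mult_right Bochner_Integration.integrable_add intG int\<Omega>)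
    have FH: "?F x \<le> ?H x" for x
    proof (cases "x \<in> \<Omega>")
      case True
      define s t where "s = A * cmod (g x)" and "t = B * ?N"
      have st: "0 \<le> s" "0 \<le> t" using AB by (auto simp: s_def t_def bergman_norm_nonneg)
      have "cmod (f x) powr p \<le> (2 * max s t) powr p"
        using le[OF True] p by (intro powr_mono2) (auto simp: s_def t_def)
      also have "\<dots> = 2 powr p * max s t powr p" using st by (simp add: powr_mult)
      also have "max s t powr p \<le> s powr p + t powr p" by (simp add: max_def)
      finally show ?thesis
        using True AB by (simp add: s_def t_def powr_mult bergman_norm_nonneg mult_ac)
    qed simp
    have "f \<in> borel_measurable sphere_measure" using holo_space_measurable[OF \<Omega> f] .
    then have [measurable]: "?F \<in> borel_measurable sphere_measure"
      using \<Omega>' by measurable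
    have intF: "integrable sphere_measure ?F"
    proof (rule Bochner_Integration.integrable_bound[OF intH])
      show "AE x in sphere_measure. norm (?F x) \<le> norm (?H x)"
      proof (rule AE_I2)
        fix x
        have "norm (?F x) = ?F x" by simp
        also have "\<dots> \<le> norm (?H x)" using FH[of x] by (metis abs_ge_self order_trans real_norm_def)
        finally show "norm (?F x) \<le> norm (?H x)" .
      qed
    qed measurable
    have "(LINT x:\<Omega>|sphere_measure. cmod (f x) powr p) \<le> integral\<^sup>L sphere_measure ?H"
      unfolding set_lebesgue_integral_def by (rule integral_mono[OF intF intH FH])
    also have "\<dots> = 2 powr p * (A powr p * integral\<^sup>L sphere_measure ?G
        + B powr p * ?N powr p * measure sphere_measure \<Omega>)"
      using intG int\<Omega> \<Omega>' by simp
    also have "\<dots> = C * ?N powr p"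
      by (simp add: bergman_norm_powr[OF p] set_lebesgue_integral_def C_def algebra_simps)
    finally have "(LINT x:\<Omega>|sphere_measure. cmod (f x) powr p) powr (1 / p) \<le> (C * ?N powr p) powr (1 / p)"
      using p set_integral_powr_nonneg by (intro powr_mono2) auto
    then have "bergman_norm p \<Omega> f \<le> C powr (1 / p) * ?N"
      unfolding bergman_norm_def[of p \<Omega> f]
      using p C0 by (simp add: powr_powr powr_mult bergman_norm_nonneg)
    then show ?thesis
      using f intF by (simp add: bergman_space_def set_integrable_def)
  qed
  then show ?thesis using that by blast
qed


section \<open>The chart at infinity\<close>

lemma sphere_inverse_involution [simp]: "sphere_inverse (sphere_inverse x) = x"
  by (cases x) auto

lemma star_eq: "star A = {l. sphere_inverse (Some l) \<notin> A}"
proof -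
  have "(\<exists>w. Some l = sphere_inverse w \<and> w \<notin> A) \<longleftrightarrow> sphere_inverse (Some l) \<notin> A" for l
    by (metis sphere_inverse_involution)
  then show ?thesis by (auto simp: star_def sphere_star_def simp del: sphere_inverse.simps)
qed

text \<open>Off u = 0 this is continuity of 1/u. If infinity belongs to the set, the complement is a
  compact subset of the plane, within radius \<open>B\<close> say, so the whole disc |u| < 1/B lies
  in the chart.\<close>

lemma open_chart_infinity:
  assumes "openin riemann_sphere \<Omega>"
  shows "open {u. sphere_inverse (Some u) \<in> \<Omega>}"
proof -
  let ?P = "{u. u \<in> - {0} \<and> 1 / u \<in> {z. Some z \<in> \<Omega>}}"
  have "open ((- {0}) \<inter> (\<lambda>u::complex. 1 / u) -` {z. Some z \<in> \<Omega>})"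
    using open_planar_part[OF assms]
    by (intro continuous_open_preimage continuous_intros) auto
  then have P: "open ?P" by (simp add: vimage_def Int_def)
  show ?thesis
  proof (cases "None \<in> \<Omega>")
    case False
    then have "{u. sphere_inverse (Some u) \<in> \<Omega>} = ?P" by auto
    with P show ?thesis by simp
  next
    case True
    then obtain C :: "complex set" where C: "compact C" "\<Omega> = insert None (Some ` (- C))"
      using assms by (auto simp: openin_Alexandroff_compactification Compl_eq_Diff_UNIV)
    obtain B where B: "0 < B" "\<And>z. z \<in> C \<Longrightarrow> cmod z \<le> B"
      using compact_imp_bounded[OF C(1)] by (auto simp: bounded_pos)
    have near: "sphere_inverse (Some u) \<in> \<Omega>" if u: "u \<in> ball 0 (1 / B)" for u
    proof (cases "u = 0")
      case False
      then have "B < cmod (1 / u)" using u B(1) by (simp add: norm_divide field_simps)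
      then have "1 / u \<notin> C" using B(2) by force
      then show ?thesis using False C(2) by auto
    qed (use True in simp)
    have "ball 0 (1 / B) \<subseteq> {u. sphere_inverse (Some u) \<in> \<Omega>}"
      by (intro subsetI CollectI near)
    moreover have "?P \<subseteq> {u. sphere_inverse (Some u) \<in> \<Omega>}" by auto
    moreover have "{u. sphere_inverse (Some u) \<in> \<Omega>} \<subseteq> ?P \<union> ball 0 (1 / B)"
    proof
      fix u assume u: "u \<in> {u. sphere_inverse (Some u) \<in> \<Omega>}"
      show "u \<in> ?P \<union> ball 0 (1 / B)"
        using u B(1) by (cases "u = 0") simp_all
    qed
    ultimately have "{u. sphere_inverse (Some u) \<in> \<Omega>} = ?P \<union> ball 0 (1 / B)"
      by (intro equalityI Un_least)
    then show ?thesis by (simp only: open_Un[OF P open_ball])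
  qed
qed

text \<open>When 1/z stays at distance \<open>\<rho>\<close> from l, the factor |1 - l z| absorbs
  both |z| and the constant 1, up to fixed factors. The hypothesis is conditional so that z = 0,
  where 1/z is infinity, counts as far from l.\<close>

lemma norm_one_minus_mult_ge:
  fixes l z :: complex
  assumes "0 < \<rho>" "z \<noteq> 0 \<Longrightarrow> \<rho> \<le> cmod (1 / z - l)"
  shows "\<rho> * cmod z \<le> cmod (1 - l * z)" "1 \<le> cmod (1 - l * z) * (1 + cmod l / \<rho>)"
proof -
  show le: "\<rho> * cmod z \<le> cmod (1 - l * z)"
  proof (cases "z = 0")
    case False
    then have "1 - l * z = (1 / z - l) * z" by (simp add: field_simps)
    then have "cmod (1 - l * z) = cmod (1 / z - l) * cmod z" by (simp only: norm_mult)
    with assms(2)[OF False] show ?thesis by (simp add: mult_right_mono)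
  qed simp
  have "1 \<le> cmod (1 - l * z) + cmod l * cmod z"
    using norm_triangle_ineq[of "1 - l * z" "l * z"] by (simp add: norm_mult)
  also have "cmod l * cmod z \<le> cmod l * (cmod (1 - l * z) / \<rho>)"
    using le assms(1) by (intro mult_left_mono) (auto simp: field_simps)
  finally show "1 \<le> cmod (1 - l * z) * (1 + cmod l / \<rho>)"
    by (simp add: algebra_simps)
qed

section \<open>Eigenfunctions\<close>

text \<open>In the chart u = 1/z this is u / (u - l). For l = 0 it is the constant 1 on the plane
  part, which is compatible with the value 0 at infinity because 0 in \<open>star \<Omega>\<close>
  means that infinity is not in the set.\<close>

definition cauchy_kernel :: "complex option set \<Rightarrow> complex \<Rightarrow> complex option \<Rightarrow> complex" where
  "cauchy_kernel \<Omega> l x =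
     (if x \<in> \<Omega> then case x of None \<Rightarrow> 0 | Some z \<Rightarrow> 1 / (1 - l * z) else 0)"

lemma star_nonzero:
  assumes "l \<in> star \<Omega>" "Some z \<in> \<Omega>"
  shows "1 - l * z \<noteq> 0"
proof
  assume "1 - l * z = 0"
  then have "l \<noteq> 0" by auto
  then have "z = 1 / l" using \<open>1 - l * z = 0\<close> by (simp add: field_simps)
  then show False using \<open>l \<noteq> 0\<close> assms by (simp add: star_eq)
qed

lemma cauchy_kernel_holo:
  assumes "l \<in> star \<Omega>"
  shows "cauchy_kernel \<Omega> l \<in> holo_space \<Omega>"
proof -
  have "(\<lambda>z. 1 / (1 - l * z)) holomorphic_on {z. Some z \<in> \<Omega>}"
    using star_nonzero[OF assms] by (intro holomorphic_intros) auto
  then have 1: "(\<lambda>z. cauchy_kernel \<Omega> l (Some z)) holomorphic_on {z. Some z \<in> \<Omega>}"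
    by (rule holomorphic_transform) (simp add: cauchy_kernel_def)
  have "(\<lambda>u. u / (u - l)) holomorphic_on {u. sphere_inverse (Some u) \<in> \<Omega>}"
    using assms by (intro holomorphic_intros) (auto simp: star_eq)
  then have 2: "(\<lambda>u. cauchy_kernel \<Omega> l (sphere_inverse (Some u))) holomorphic_on
      {u. sphere_inverse (Some u) \<in> \<Omega>}"
    by (rule holomorphic_transform) (auto simp: cauchy_kernel_def field_simps)
  show ?thesis
    using 1 2 by (simp add: holo_space_def) (simp add: cauchy_kernel_def)
qed

lemma taylor_shift_cauchy_kernel:
  assumes \<Omega>: "openin riemann_sphere \<Omega>" "Some 0 \<in> \<Omega>" and l: "l \<in> star \<Omega>"
  shows "taylor_shift \<Omega> (cauchy_kernel \<Omega> l) = (\<lambda>x. l * cauchy_kernel \<Omega> l x)"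
proof
  fix x
  let ?O = "{z. Some z \<in> \<Omega>}"
  have "((\<lambda>z. 1 / (1 - l * z)) has_field_derivative l) (at 0)"
    by (auto intro!: derivative_eq_intros)
  then have "((\<lambda>z. cauchy_kernel \<Omega> l (Some z)) has_field_derivative l) (at 0)"
    by (rule has_field_derivative_transform_within_open[where S = ?O])
      (use open_planar_part[OF \<Omega>(1)] \<Omega>(2) in \<open>auto simp: cauchy_kernel_def\<close>)
  then have d: "deriv (\<lambda>z. cauchy_kernel \<Omega> l (Some z)) 0 = l"
    by (rule DERIV_imp_deriv)
  show "taylor_shift \<Omega> (cauchy_kernel \<Omega> l) x = l * cauchy_kernel \<Omega> l x"
  proof (cases x)
    case (Some z)
    then show ?thesis
      using d \<Omega>(2) star_nonzero[OF l, of z]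
      by (auto simp: taylor_shift_def) (auto simp: cauchy_kernel_def field_simps)
  qed (simp add: taylor_shift_def cauchy_kernel_def)
qed

lemma star_in_point_spectrum:
  assumes "openin riemann_sphere \<Omega>" "Some 0 \<in> \<Omega>" "l \<in> star \<Omega>"
    and "cauchy_kernel \<Omega> l \<in> bergman_space p \<Omega>"
  shows "l \<in> taylor_point_spectrum p \<Omega>"
proof -
  have "cauchy_kernel \<Omega> l (Some 0) = 1" using assms(2) by (simp add: cauchy_kernel_def)
  then have "cauchy_kernel \<Omega> l \<noteq> (\<lambda>z. 0)" by (metis zero_neq_one)
  then show ?thesis
    unfolding point_spectrum_on_def using assms taylor_shift_cauchy_kernel by blast
qed

text \<open>A disc of radius \<open>e\<close> around l inside \<open>star \<Omega>\<close> keeps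
  every 1/z with z in the set at distance at least \<open>e\<close> from l, so |1 - l z| is bounded
  below. Bounded functions are p-integrable for a finite measure.\<close>

lemma cauchy_kernel_bergman_interior:
  assumes \<Omega>: "openin riemann_sphere \<Omega>" and l: "l \<in> interior (star \<Omega>)" and p: "1 \<le> p"
  shows "cauchy_kernel \<Omega> l \<in> bergman_space p \<Omega>"
proof -
  interpret finite_measure sphere_measure by (rule finite_measure_sphere)
  have holo: "cauchy_kernel \<Omega> l \<in> holo_space \<Omega>"
    using l interior_subset cauchy_kernel_holo by blast
  note [measurable] = holo_space_measurable[OF \<Omega> holo] openin_sphere_sets[OF \<Omega>]
  obtain e where e: "0 < e" "ball l e \<subseteq> star \<Omega>" using l by (auto simp: mem_interior)
  have bnd: "cmod (cauchy_kernel \<Omega> l x) \<le> 1 + cmod l / e" for x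
  proof (cases "x \<in> \<Omega> \<and> x \<noteq> None")
    case True
    then obtain z where z: "x = Some z" "Some z \<in> \<Omega>" by auto
    have "e \<le> cmod (1 / z - l)" if "z \<noteq> 0"
    proof (rule ccontr)
      assume "\<not> ?thesis"
      then have "1 / z \<in> star \<Omega>" using e(2) by (auto simp: dist_norm norm_minus_commute)
      then show False using z that by (simp add: star_eq)
    qed
    from norm_one_minus_mult_ge(2)[OF e(1) this]
    have *: "1 \<le> cmod (1 - l * z) * (1 + cmod l / e)" by simp
    then have "0 < cmod (1 - l * z)" by (cases "cmod (1 - l * z) = 0") auto
    with * show ?thesis using z by (simp add: cauchy_kernel_def norm_divide divide_simps mult_ac)
  next
    case False
    then show ?thesis using e(1) by (auto simp: cauchy_kernel_def)
  qed
  have "integrable sphere_measure (\<lambda>x. indicat_real \<Omega> x *\<^sub>R cmod (cauchy_kernel \<Omega> l x) powr p)"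
    by (rule integrable_const_bound[where B = "(1 + cmod l / e) powr p"])
      (use bnd p in \<open>auto simp: indicator_def intro!: powr_mono2\<close>)
  then show ?thesis using holo by (simp add: bergman_space_def set_integrable_def)
qed

text \<open>The shell 2^(-k-1) <= |z - a| < 2^(-k) contributes at most a multiple of 2^(p (k+1))
  4^(-k), a geometric term of ratio 2^p / 4, which is below 1 as p < 2. At z = a the integrand is 0
  by the convention \<open>0 powr x = 0\<close>.\<close>

lemma nn_integral_inverse_power_finite:
  fixes a :: complex
  assumes p: "0 \<le> p" "p < 2"
  shows "(\<integral>\<^sup>+z. ennreal (indicator (ball a 1) z * cmod (z - a) powr (- p)) \<partial>lborel) < \<infinity>"
proof (rule nn_integral_dominated_balls_finite[where a = a and r = "\<lambda>k. (1 / 2) ^ k"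
      and c = "\<lambda>k. (2 powr p) ^ (k + 1)"])
  fix z :: complex
  assume "ennreal (indicator (ball a 1) z * cmod (z - a) powr (- p)) \<noteq> 0"
  then have z: "cmod (z - a) < 1" "0 < cmod (z - a)"
    by (auto simp: indicator_def dist_norm norm_minus_commute split: if_splits)
  define n where "n = (LEAST n. (1 / 2) ^ n \<le> cmod (z - a))"
  have "\<exists>n. (1 / 2) ^ n \<le> cmod (z - a)"
    using real_arch_pow_inv[OF z(2), of "1 / 2"] by (auto intro: less_imp_le)
  then have n: "(1 / 2) ^ n \<le> cmod (z - a)" unfolding n_def by (rule LeastI_ex)
  have "n \<noteq> 0" using n z by (cases n) auto
  then obtain k where k: "n = Suc k" by (cases n) auto
  have ub: "cmod (z - a) < (1 / 2) ^ k"
    using not_less_Least[of k "\<lambda>n. (1 / 2) ^ n \<le> cmod (z - a)"] k unfolding n_def by fastforce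
  \<comment> \<open>The inner radius of the shell bounds the integrand and the outer radius gives
    the ball; hence exponent k + 1 in one and k in the other.\<close>
  have "cmod (z - a) powr (- p) \<le> ((1 / 2) ^ n) powr (- p)"
    using n p by (intro powr_mono2') auto
  also have "((1 / 2 :: real) ^ n) powr (- p) = (2 powr p) ^ n"
    by (simp add: powr_minus powr_divide power_one_over powr_power powr_powr mult.commute flip: powr_realpow)
  finally show "\<exists>k. z \<in> ball a ((1 / 2) ^ k) \<and>
      ennreal (indicator (ball a 1) z * cmod (z - a) powr (- p)) \<le> ennreal ((2 powr p) ^ (k + 1))"
    using ub z by (intro exI[of _ k]) (auto simp: k dist_norm norm_minus_commute intro!: ennreal_leI)
next
  have "(2::real) powr p < 2 powr 2" using p by (intro powr_less_mono) auto
  then have "summable (\<lambda>k. 2 powr p * (2 powr p / 4) ^ k)"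
    by (intro summable_mult summable_geometric) simp
  also have "(\<lambda>k. 2 powr p * (2 powr p / 4) ^ k) = (\<lambda>k. (2 powr p) ^ (k + 1) * ((1 / 2) ^ k)\<^sup>2)"
  proof
    fix k :: nat
    have "((1 / 2 :: real) ^ k)\<^sup>2 = ((1 / 2)\<^sup>2) ^ k" by (metis power_mult mult.commute)
    then show "2 powr p * (2 powr p / 4) ^ k = (2 powr p) ^ (k + 1) * ((1 / 2) ^ k)\<^sup>2"
      by (simp add: power_divide)
  qed
  finally show "summable (\<lambda>k. (2 powr p) ^ (k + 1) * ((1 / 2) ^ k)\<^sup>2)" .
qed auto

text \<open>The only possible singularity is the pole at 1/l. Inside the unit ball around it the
  density is at most 1 and the power is integrable; outside it the kernel is bounded and the density
  is integrable.\<close>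

lemma cauchy_kernel_bergman:
  assumes \<Omega>: "openin riemann_sphere \<Omega>" and l: "l \<in> star \<Omega>" and p: "1 \<le> p" "p < 2"
  shows "cauchy_kernel \<Omega> l \<in> bergman_space p \<Omega>"
proof -
  have holo: "cauchy_kernel \<Omega> l \<in> holo_space \<Omega>" using l cauchy_kernel_holo by blast
  note [measurable] = holo_space_measurable[OF \<Omega> holo] openin_sphere_sets[OF \<Omega>]
  let ?f = "\<lambda>x. indicat_real \<Omega> x *\<^sub>R cmod (cauchy_kernel \<Omega> l x) powr p"
  define a where "a = 1 / l"
  define s where "s z = indicator (ball a 1) z * cmod (z - a) powr (- p)" for z
  \<comment> \<open>The 1 covers l = 0, where the kernel is 1 while \<open>cmod l powr (- p)\<close>
    is 0 by convention.\<close>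
  define C where "C = max 1 (cmod l powr (- p))"
  have C: "0 \<le> C" by (simp add: C_def)
  have le: "sphere_density z * ?f (Some z) \<le> C * (s z + sphere_density z)" for z
  proof (cases "Some z \<in> \<Omega>")
    case True
    have "sphere_density z * cmod (cauchy_kernel \<Omega> l (Some z)) powr p \<le> C * (s z + sphere_density z)"
    proof (cases "l = 0")
      case True
      then show ?thesis using \<open>Some z \<in> \<Omega>\<close> sphere_density_pos[of z]
        by (simp add: cauchy_kernel_def C_def s_def)
    next
      case False
      have "1 - l * z = - (l * (z - a))" using False by (simp add: a_def field_simps)
      then have "cmod (1 - l * z) = cmod l * cmod (z - a)" by (simp add: norm_mult)
      then have eq: "cmod (cauchy_kernel \<Omega> l (Some z)) powr p = cmod l powr (- p) * cmod (z - a) powr (- p)"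
        using True by (simp add: cauchy_kernel_def norm_divide powr_divide powr_mult powr_minus divide_simps)
      show ?thesis
      proof (cases "z \<in> ball a 1")
        case True
        then have s: "s z = cmod (z - a) powr (- p)" by (simp add: s_def)
        have 1: "cmod (cauchy_kernel \<Omega> l (Some z)) powr p \<le> C * s z"
          unfolding eq s by (intro mult_right_mono) (auto simp: C_def)
        moreover have "C * s z \<ge> 0" using C by (simp add: s)
        moreover have "sphere_density z * (C * s z) \<le> C * s z"
          using sphere_density_le_1[of z] calculation(2) by (simp add: mult_left_le_one_le less_imp_le[OF sphere_density_pos])
        moreover have "sphere_density z * cmod (cauchy_kernel \<Omega> l (Some z)) powr p \<le> sphere_density z * (C * s z)"
          using 1 by (intro mult_left_mono) (auto intro: less_imp_le[OF sphere_density_pos])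
        moreover have "0 \<le> C * sphere_density z" using C by (simp add: less_imp_le[OF sphere_density_pos])
        ultimately show ?thesis using C by (simp add: algebra_simps)
      next
        case False
        then have s: "s z = 0" and "1 \<le> cmod (z - a)" by (auto simp: s_def dist_norm norm_minus_commute)
        then have "cmod (z - a) powr (- p) \<le> 1"
          using p powr_mono2'[of "- p" 1 "cmod (z - a)"] by simp
        then have "cmod (cauchy_kernel \<Omega> l (Some z)) powr p \<le> C * 1"
          unfolding eq by (intro mult_mono) (auto simp: C_def)
        then show ?thesis using sphere_density_pos[of z] by (simp add: s mult.commute)
      qed
    qed
    then show ?thesis using True by simp
  next
    case False
    then show ?thesis using C sphere_density_pos[of z] by (simp add: s_def)
  qed
  have "(\<integral>\<^sup>+x. ennreal (?f x) \<partial>sphere_measure)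
      = (\<integral>\<^sup>+z. ennreal (sphere_density z) * ennreal (?f (Some z)) \<partial>lborel)"
    by (rule nn_integral_sphere) measurable
  also have "\<dots> \<le> (\<integral>\<^sup>+z. ennreal C * (ennreal (s z) + ennreal (sphere_density z)) \<partial>lborel)"
  proof (rule nn_integral_mono)
    fix z
    have s0: "0 \<le> s z" by (simp add: s_def)
    have "ennreal (sphere_density z) * ennreal (?f (Some z)) = ennreal (sphere_density z * ?f (Some z))"
      by (intro ennreal_mult[symmetric]) (auto intro: less_imp_le[OF sphere_density_pos])
    also have "\<dots> \<le> ennreal (C * (s z + sphere_density z))"
      using le by (rule ennreal_leI)
    also have "\<dots> = ennreal C * (ennreal (s z) + ennreal (sphere_density z))"
      using C s0 sphere_density_pos[of z] by (simp add: ennreal_mult ennreal_plus)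
    finally show "ennreal (sphere_density z) * ennreal (?f (Some z))
        \<le> ennreal C * (ennreal (s z) + ennreal (sphere_density z))" .
  qed
  also have "\<dots> = ennreal C * ((\<integral>\<^sup>+z. ennreal (s z) \<partial>lborel)
      + (\<integral>\<^sup>+z. ennreal (sphere_density z) \<partial>lborel))"
  proof -
    have "indicator (ball a 1) \<in> borel_measurable (borel :: complex measure)"
      by (intro borel_measurable_indicator) simp
    then have [measurable]: "s \<in> borel_measurable borel" unfolding s_def by measurable
    show ?thesis by (subst nn_integral_cmult, simp) (subst nn_integral_add, auto)
  qed
  also have "\<dots> < \<infinity>"
    using nn_integral_inverse_power_finite[of p a] nn_integral_sphere_density_finite p
    by (simp add: s_def ennreal_mult_less_top)
  finally have "(\<integral>\<^sup>+x. ennreal (?f x) \<partial>sphere_measure) < \<infinity>" .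
  then have "integrable sphere_measure ?f"
    by (intro integrableI_nonneg) auto
  then show ?thesis using holo by (simp add: bergman_space_def set_integrable_def)
qed

section \<open>Approximate eigenvalues\<close>

lemma point_spectrum_subset_spectrum: "point_spectrum_on X T \<subseteq> spectrum_on X N T"
proof
  fix l assume "l \<in> point_spectrum_on X T"
  then obtain f where f: "f \<in> X" "f \<noteq> (\<lambda>z. 0)" "T f = (\<lambda>z. l * f z)"
    by (auto simp: point_spectrum_on_def)
  show "l \<in> spectrum_on X N T"
    unfolding spectrum_on_def
  proof (clarify)
    fix S assume S: "bounded_operator_on X N S" "\<forall>f\<in>X. S (\<lambda>z. T f z - l * f z) = f"
    \<comment> \<open>Zero is written as \<open>0 * f\<close> so that homogeneity of
      \<open>S\<close> on the carrier applies.\<close>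
    have "f = S (\<lambda>z. 0 * f z)" using S(2) f by force
    also have "\<dots> = (\<lambda>z. 0 * S f z)" using S(1) f(1) unfolding bounded_operator_on_def by blast
    finally show False using f(2) by simp
  qed
qed

lemma bergman_norm_scale:
  assumes "1 \<le> p"
  shows "bergman_norm p \<Omega> (\<lambda>z. c * f z) = cmod c * bergman_norm p \<Omega> f"
  using assms unfolding bergman_norm_def
  by (simp add: norm_mult powr_mult powr_powr set_integral_powr_nonneg)

lemma bergman_norm_pos:
  assumes "openin riemann_sphere \<Omega>" "1 \<le> p" "f \<in> bergman_space p \<Omega>" "Some a \<in> \<Omega>" "f (Some a) \<noteq> 0"
  shows "0 < bergman_norm p \<Omega> f"
proof -
  obtain C where "\<And>f. f \<in> bergman_space p \<Omega> \<Longrightarrow> cmod (f (Some a)) \<le> C * bergman_norm p \<Omega> f"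
    by (rule bergman_point_evaluation_bounded[OF assms(1,2), of "{a}"]) (use assms(4) in auto)
  with assms(3,5) have "bergman_norm p \<Omega> f \<noteq> 0" by fastforce
  then show ?thesis using bergman_norm_nonneg[of p \<Omega> f] by simp
qed

text \<open>An inverse of T - l would have to multiply an eigenfunction for m by 1 / (m - l), which
  exceeds any fixed operator bound once m is close enough to l.\<close>

lemma closure_interior_star_subset_spectrum:
  assumes \<Omega>: "openin riemann_sphere \<Omega>" "Some 0 \<in> \<Omega>" and p: "1 \<le> p"
  shows "closure (interior (star \<Omega>)) \<subseteq> taylor_spectrum p \<Omega>"
proof
  fix l assume l: "l \<in> closure (interior (star \<Omega>))"
  let ?N = "bergman_norm p \<Omega>" and ?X = "bergman_space p \<Omega>"
  show "l \<in> taylor_spectrum p \<Omega>"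
    unfolding spectrum_on_def
  proof clarify
    fix S assume S: "bounded_operator_on ?X ?N S"
      "\<forall>f\<in>?X. S (\<lambda>z. taylor_shift \<Omega> f z - l * f z) = f"
    obtain C where C: "\<And>f. f \<in> ?X \<Longrightarrow> ?N (S f) \<le> C * ?N f"
      using S(1) unfolding bounded_operator_on_def by blast
    \<comment> \<open>The bound \<open>C\<close> may be zero or negative;
      \<open>\<bar>C\<bar> + 1\<close> is a positive bound that still dominates it.\<close>
    have "0 < 1 / (\<bar>C\<bar> + 1)" by simp
    then obtain m where m: "m \<in> interior (star \<Omega>)" "dist m l < 1 / (\<bar>C\<bar> + 1)"
      using l closure_approachable by blast
    let ?f = "cauchy_kernel \<Omega> m"
    have f: "?f \<in> ?X" using cauchy_kernel_bergman_interior[OF \<Omega>(1) m(1) p] .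
    have pos: "0 < ?N ?f"
      using \<Omega> p f by (intro bergman_norm_pos[where a = 0]) (auto simp: cauchy_kernel_def)
    have "m \<in> star \<Omega>" using m(1) interior_subset by blast
    then have "(\<lambda>z. taylor_shift \<Omega> ?f z - l * ?f z) = (\<lambda>z. (m - l) * ?f z)"
      by (simp add: taylor_shift_cauchy_kernel[OF \<Omega>] algebra_simps)
    then have "?f = S (\<lambda>z. (m - l) * ?f z)" using S(2) f by metis
    also have "\<dots> = (\<lambda>z. (m - l) * S ?f z)"
      using S(1) f unfolding bounded_operator_on_def by blast
    finally have "?N ?f = cmod (m - l) * ?N (S ?f)" using bergman_norm_scale[OF p] by metis
    also have "\<dots> \<le> cmod (m - l) * ((\<bar>C\<bar> + 1) * ?N ?f)"
    proof (intro mult_left_mono)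
      have "?N (S ?f) \<le> C * ?N ?f" using C f .
      also have "\<dots> \<le> (\<bar>C\<bar> + 1) * ?N ?f" using pos by (intro mult_right_mono) auto
      finally show "?N (S ?f) \<le> (\<bar>C\<bar> + 1) * ?N ?f" .
    qed simp
    also have "\<dots> = (cmod (m - l) * (\<bar>C\<bar> + 1)) * ?N ?f" by simp
    also have "\<dots> < 1 * ?N ?f"
      using m(2) pos by (intro mult_strict_right_mono) (auto simp: dist_norm field_simps)
    finally show False by simp
  qed
qed


section \<open>The resolvent\<close>

text \<open>With \<open>u = 1/z\<close> and \<open>G u = g (1/u)\<close>, the equation \<open>T f - l f = g\<close> becomes
  \<open>(u - l) f (1/u) = G u + f 0 u\<close>. Regularity at \<open>u = l\<close> and vanishing at \<open>u = 0\<close> force the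
  value \<open>- f 0\<close>, which is \<open>resolvent_const\<close>.\<close>

definition resolvent_const :: "complex \<Rightarrow> (complex option \<Rightarrow> complex) \<Rightarrow> complex" where
  "resolvent_const l g =
     (if l = 0 then deriv (\<lambda>u. g (sphere_inverse (Some u))) 0 else g (sphere_inverse (Some l)) / l)"

text \<open>At u = l the quotient takes the derivative of its numerator, the value that removes the
  singularity.\<close>

definition resolvent_chart :: "complex \<Rightarrow> (complex option \<Rightarrow> complex) \<Rightarrow> complex \<Rightarrow> complex" where
  "resolvent_chart l g u =
     (if u = l then deriv (\<lambda>u. g (sphere_inverse (Some u))) l - resolvent_const l g
      else (g (sphere_inverse (Some u)) - resolvent_const l g * u) / (u - l))"

text \<open>The point z = 0 is u = infinity and lies outside the chart; the quotient tends to
  \<open>- resolvent_const l g\<close> there.\<close>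

definition resolvent ::
    "complex option set \<Rightarrow> complex \<Rightarrow> (complex option \<Rightarrow> complex) \<Rightarrow> complex option \<Rightarrow> complex" where
  "resolvent \<Omega> l g x =
     (if x \<notin> \<Omega> then 0
      else case x of
        None \<Rightarrow> resolvent_chart l g 0
      | Some z \<Rightarrow> if z = 0 then - resolvent_const l g else resolvent_chart l g (1 / z))"

lemma holo_space_None: "g \<in> holo_space \<Omega> \<Longrightarrow> g None = 0"
  by (auto simp: holo_space_def)

lemma holo_space_chart_infinity:
  "g \<in> holo_space \<Omega> \<Longrightarrow>
    (\<lambda>u. g (sphere_inverse (Some u))) holomorphic_on {u. sphere_inverse (Some u) \<in> \<Omega>}"
  by (simp add: holo_space_def)

section \<open>Solving the resolvent equation at a point l whose inverse lies in the set\<close>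

locale resolvent_point =
  fixes \<Omega> :: "complex option set" and l :: complex
  assumes \<Omega>: "openin riemann_sphere \<Omega>" and zero: "Some 0 \<in> \<Omega>" and l: "l \<notin> star \<Omega>"
begin

lemma l_chart: "sphere_inverse (Some l) \<in> \<Omega>"
  using l by (simp add: star_eq del: sphere_inverse.simps)

lemma chart_derivative:
  assumes "g \<in> holo_space \<Omega>"
  shows "((\<lambda>u. g (sphere_inverse (Some u))) has_field_derivative
    deriv (\<lambda>u. g (sphere_inverse (Some u))) l) (at l)"
  using holomorphic_derivI[OF holo_space_chart_infinity[OF assms] open_chart_infinity[OF \<Omega>]] l_chart
  by blast

lemma chart_numerator_zero:
  assumes "g \<in> holo_space \<Omega>"
  shows "g (sphere_inverse (Some l)) - resolvent_const l g * l = 0"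
  using holo_space_None[OF assms] by (simp add: resolvent_const_def)

lemma resolvent_chart_holomorphic:
  assumes g: "g \<in> holo_space \<Omega>"
  shows "resolvent_chart l g holomorphic_on {u. sphere_inverse (Some u) \<in> \<Omega>}"
proof -
  define G where "G = (\<lambda>u. g (sphere_inverse (Some u)))"
  let ?c = "resolvent_const l g"
  let ?U = "{u. sphere_inverse (Some u) \<in> \<Omega>}"
  have hol: "(\<lambda>u. G u - ?c * u) holomorphic_on ?U"
    using holo_space_chart_infinity[OF g] unfolding G_def by (intro holomorphic_intros)
  have zero: "G l - ?c * l = 0"
    using chart_numerator_zero[OF g] by (simp only: G_def)
  have "((\<lambda>u. G u - ?c * u) has_field_derivative deriv G l - ?c) (at l)"
    using chart_derivative[OF g] unfolding G_def by (auto intro!: derivative_eq_intros simp del: sphere_inverse.simps)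
  then have "deriv (\<lambda>u. G u - ?c * u) l = deriv G l - ?c" by (rule DERIV_imp_deriv)
  \<comment> \<open>As the numerator vanishes at l, the chart function is its difference quotient at
    l, the form in which the removable singularity theorem applies.\<close>
  then have "resolvent_chart l g
      = (\<lambda>u. if u = l then deriv (\<lambda>u. G u - ?c * u) l else ((G u - ?c * u) - (G l - ?c * l)) / (u - l))"
    unfolding zero by (auto simp: resolvent_chart_def G_def fun_eq_iff simp del: sphere_inverse.simps)
  then show ?thesis
    using pole_lemma_open[OF hol open_chart_infinity[OF \<Omega>], of l] by simp
qed

lemma resolvent_chart_zero:
  assumes "g \<in> holo_space \<Omega>"
  shows "resolvent_chart l g 0 = 0"
  using holo_space_None[OF assms] by (simp add: resolvent_chart_def resolvent_const_def)

text \<open>The chart equation multiplied by z. In this form it also holds at z = 0 and at the pole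
  1/l, where both sides vanish, so later arguments can use it on the whole plane part.\<close>

lemma resolvent_mult:
  assumes g: "g \<in> holo_space \<Omega>" and z: "Some z \<in> \<Omega>"
  shows "resolvent \<Omega> l g (Some z) * (1 - l * z) = z * g (Some z) - resolvent_const l g"
proof (cases "z = 0")
  case True
  then show ?thesis using z by (simp add: resolvent_def)
next
  case False
  show ?thesis
  proof (cases "1 / z = l")
    case True
    then have "l \<noteq> 0" "z = 1 / l" using False by auto
    then show ?thesis by (simp add: resolvent_const_def)
  next
    case neq: False
    have "1 - l * z = (1 / z - l) * z" using False by (simp add: field_simps)
    then show ?thesis
      using z False neq by (simp add: resolvent_def resolvent_chart_def field_simps)
  qed
qed

text \<open>The plane part is covered by two open sets: z \<noteq> 0, where the chart formula is
  holomorphic, and 1 - l z \<noteq> 0, which contains 0 and where dividing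
  \<open>resolvent_mult\<close> gives a holomorphic quotient.\<close>

lemma resolvent_holo:
  assumes g: "g \<in> holo_space \<Omega>"
  shows "resolvent \<Omega> l g \<in> holo_space \<Omega>"
proof -
  let ?O = "{z. Some z \<in> \<Omega>}" and ?U = "{u. sphere_inverse (Some u) \<in> \<Omega>}"
  have openO: "open ?O" using open_planar_part[OF \<Omega>] .
  have chart: "resolvent \<Omega> l g (sphere_inverse (Some u)) = resolvent_chart l g u" if "u \<in> ?U" for u
    using that by (auto simp: resolvent_def split: if_splits)
  have 2: "(\<lambda>u. resolvent \<Omega> l g (sphere_inverse (Some u))) holomorphic_on ?U"
    using resolvent_chart_holomorphic[OF g] by (rule holomorphic_transform) (simp add: chart del: sphere_inverse.simps)
  have "(\<lambda>z. resolvent_chart l g (1 / z)) holomorphic_on (?O - {0})"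
  proof -
    have "(resolvent_chart l g \<circ> (\<lambda>z. 1 / z)) holomorphic_on (?O - {0})"
      by (rule holomorphic_on_compose_gen[OF _ resolvent_chart_holomorphic[OF g]])
        (auto intro!: holomorphic_intros)
    then show ?thesis by (simp add: o_def)
  qed
  then have 3: "(\<lambda>z. resolvent \<Omega> l g (Some z)) holomorphic_on (?O - {0})"
    by (rule holomorphic_transform) (simp add: resolvent_def)
  have openN: "open (?O \<inter> {z. 1 - l * z \<noteq> 0})"
    using openO by (intro open_Int open_Collect_neq continuous_intros) auto
  have "(\<lambda>z. (z * g (Some z) - resolvent_const l g) / (1 - l * z)) holomorphic_on (?O \<inter> {z. 1 - l * z \<noteq> 0})"
  proof -
    have "(\<lambda>z. g (Some z)) holomorphic_on (?O \<inter> {z. 1 - l * z \<noteq> 0})"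
      using g by (auto simp: holo_space_def intro: holomorphic_on_subset)
    then show ?thesis by (intro holomorphic_intros) auto
  qed
  then have 4: "(\<lambda>z. resolvent \<Omega> l g (Some z)) holomorphic_on (?O \<inter> {z. 1 - l * z \<noteq> 0})"
    by (rule holomorphic_transform) (auto simp: resolvent_mult[OF g, symmetric])
  have "(\<lambda>z. resolvent \<Omega> l g (Some z)) holomorphic_on ((?O - {0}) \<union> (?O \<inter> {z. 1 - l * z \<noteq> 0}))"
    using 3 4 openO openN by (intro holomorphic_on_Un) auto
  moreover have "(?O - {0}) \<union> (?O \<inter> {z. 1 - l * z \<noteq> 0}) = ?O" by auto
  ultimately have 1: "(\<lambda>z. resolvent \<Omega> l g (Some z)) holomorphic_on ?O" by simp
  show ?thesis
    unfolding holo_space_def using 1 2 resolvent_chart_zero[OF g]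
    by (simp add: resolvent_def del: sphere_inverse.simps)
qed

lemma taylor_shift_resolvent:
  assumes g: "g \<in> holo_space \<Omega>"
  shows "(\<lambda>x. taylor_shift \<Omega> (resolvent \<Omega> l g) x - l * resolvent \<Omega> l g x) = g"
proof
  fix x
  let ?f = "resolvent \<Omega> l g" and ?c = "resolvent_const l g"
  have f: "?f \<in> holo_space \<Omega>" using resolvent_holo[OF g] .
  have f0: "?f (Some 0) = - ?c" using zero by (simp add: resolvent_def)
  show "taylor_shift \<Omega> ?f x - l * ?f x = g x"
  proof (cases "x \<in> \<Omega>")
    case False
    then show ?thesis using f g by (simp add: taylor_shift_def holo_space_def)
  next
    case True
    show ?thesis
    proof (cases x)
      case None
      then show ?thesis using True holo_space_None[OF f] holo_space_None[OF g]
        by (simp add: taylor_shift_def)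
    next
      case (Some z)
      then have z: "Some z \<in> \<Omega>" using True by simp
      have eq: "?f (Some w) * (1 - l * w) = w * g (Some w) - ?c" if "Some w \<in> \<Omega>" for w
        using resolvent_mult[OF g that] .
      show ?thesis
      proof (cases "z = 0")
        case False
        have "(?f (Some z) + ?c) / z - l * ?f (Some z) = (?f (Some z) * (1 - l * z) + ?c) / z"
          using False by (simp add: field_simps)
        also have "\<dots> = g (Some z)" using False eq[OF z] by simp
        finally show ?thesis using False z f0 by (simp add: Some taylor_shift_def)
      next
        case True
        let ?O = "{z. Some z \<in> \<Omega>}"
        have op: "open ?O" using open_planar_part[OF \<Omega>] .
        have "(\<lambda>w. ?f (Some w)) holomorphic_on ?O" "(\<lambda>w. g (Some w)) holomorphic_on ?O"
          using f g by (auto simp: holo_space_def)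
        then have df: "((\<lambda>w. ?f (Some w)) has_field_derivative deriv (\<lambda>w. ?f (Some w)) 0) (at 0)"
          and dg: "((\<lambda>w. g (Some w)) has_field_derivative deriv (\<lambda>w. g (Some w)) 0) (at 0)"
          using op zero by (auto intro: holomorphic_derivI)
        \<comment> \<open>At 0 the shift is a derivative, so the identity f(w) (1 - l w) = w g(w) -
          c is differentiated at 0 on both sides.\<close>
        have "((\<lambda>w. w * g (Some w) - ?c) has_field_derivative g (Some 0)) (at 0)"
          using dg by (auto intro!: derivative_eq_intros)
        then have "((\<lambda>w. ?f (Some w) * (1 - l * w)) has_field_derivative g (Some 0)) (at 0)"
          by (rule has_field_derivative_transform_within_open[OF _ op]) (use zero eq in auto)
        moreover have "((\<lambda>w. ?f (Some w) * (1 - l * w)) has_field_derivative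
            deriv (\<lambda>w. ?f (Some w)) 0 - l * ?f (Some 0)) (at 0)"
          using df by (auto intro!: derivative_eq_intros)
        ultimately have "deriv (\<lambda>w. ?f (Some w)) 0 - l * ?f (Some 0) = g (Some 0)"
          by (metis DERIV_unique)
        then show ?thesis using True zero by (simp add: Some taylor_shift_def)
      qed
    qed
  qed
qed

text \<open>Uniqueness of the solution. In the chart the image of f is (u - l) F(u) - u f(0): at u =
  l its value, or for l = 0 its derivative, recovers f(0), and division by u - l then returns
  F.\<close>

lemma resolvent_taylor_shift:
  assumes f: "f \<in> holo_space \<Omega>"
  shows "resolvent \<Omega> l (\<lambda>x. taylor_shift \<Omega> f x - l * f x) = f"
proof -
  define g where "g x = taylor_shift \<Omega> f x - l * f x" for x
  define F where "F u = f (sphere_inverse (Some u))" for u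
  let ?U = "{u. sphere_inverse (Some u) \<in> \<Omega>}"
  let ?f0 = "f (Some 0)"
  have G: "g (sphere_inverse (Some u)) = (u - l) * F u - u * ?f0" if "u \<in> ?U" for u
  proof (cases "u = 0")
    case True
    then show ?thesis using that holo_space_None[OF f] by (simp add: g_def F_def taylor_shift_def)
  next
    case False
    then show ?thesis using that by (simp add: g_def F_def taylor_shift_def field_simps)
  qed
  have "(F has_field_derivative deriv F l) (at l)"
    using chart_derivative[OF f] unfolding F_def .
  then have "((\<lambda>u. (u - l) * F u - u * ?f0) has_field_derivative F l - ?f0) (at l)"
    by (auto intro!: derivative_eq_intros)
  then have "((\<lambda>u. g (sphere_inverse (Some u))) has_field_derivative F l - ?f0) (at l)"
    by (rule has_field_derivative_transform_within_open[OF _ open_chart_infinity[OF \<Omega>]])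
      (use l_chart G in \<open>auto simp del: sphere_inverse.simps\<close>)
  then have d: "deriv (\<lambda>u. g (sphere_inverse (Some u))) l = F l - ?f0"
    by (rule DERIV_imp_deriv)
  have c: "resolvent_const l g = - ?f0"
  proof (cases "l = 0")
    case True
    then show ?thesis using d holo_space_None[OF f] by (simp add: resolvent_const_def F_def)
  next
    case False
    have "resolvent_const l g = g (sphere_inverse (Some l)) / l"
      using False by (simp add: resolvent_const_def)
    also have "\<dots> = - ?f0" using G[of l] l_chart False by (simp del: sphere_inverse.simps)
    finally show ?thesis .
  qed
  have chart: "resolvent_chart l g u = F u" if "u \<in> ?U" for u
  proof (cases "u = l")
    case True
    then show ?thesis unfolding resolvent_chart_def c using d by simp
  next
    case False
    then show ?thesis unfolding resolvent_chart_def c G[OF that] by simp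
  qed
  have "resolvent \<Omega> l g x = f x" for x
  proof (cases "x \<in> \<Omega>")
    case False
    then show ?thesis using f by (simp add: resolvent_def holo_space_def)
  next
    case True
    then show ?thesis
      using chart[of 0] chart[of "1 / the x"] c
      by (cases x) (auto simp: resolvent_def F_def)
  qed
  then show ?thesis by (simp add: g_def[abs_def] fun_eq_iff)
qed

section \<open>Linearity and boundedness of the resolvent\<close>

lemma resolvent_add:
  assumes "f \<in> holo_space \<Omega>" "g \<in> holo_space \<Omega>"
  shows "resolvent \<Omega> l (\<lambda>x. f x + g x) = (\<lambda>x. resolvent \<Omega> l f x + resolvent \<Omega> l g x)"
proof -
  have d: "deriv (\<lambda>u. f (sphere_inverse (Some u)) + g (sphere_inverse (Some u))) l
      = deriv (\<lambda>u. f (sphere_inverse (Some u))) l + deriv (\<lambda>u. g (sphere_inverse (Some u))) l"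
    by (intro DERIV_imp_deriv DERIV_add chart_derivative assms)
  have c: "resolvent_const l (\<lambda>x. f x + g x) = resolvent_const l f + resolvent_const l g"
    using d by (auto simp: resolvent_const_def add_divide_distrib simp del: sphere_inverse.simps)
  have split: "a + b - (c + d) * u = (a - c * u) + (b - d * u)" for a b c d u :: complex
    by (simp add: algebra_simps)
  have "resolvent_chart l (\<lambda>x. f x + g x) u = resolvent_chart l f u + resolvent_chart l g u" for u
    unfolding resolvent_chart_def c d split by (simp add: add_divide_distrib del: sphere_inverse.simps)
  with c show ?thesis by (auto simp: resolvent_def fun_eq_iff split: option.splits)
qed

lemma resolvent_scale:
  assumes "f \<in> holo_space \<Omega>"
  shows "resolvent \<Omega> l (\<lambda>x. k * f x) = (\<lambda>x. k * resolvent \<Omega> l f x)"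
proof -
  have d: "deriv (\<lambda>u. k * f (sphere_inverse (Some u))) l = k * deriv (\<lambda>u. f (sphere_inverse (Some u))) l"
    by (intro DERIV_imp_deriv DERIV_cmult chart_derivative assms)
  have c: "resolvent_const l (\<lambda>x. k * f x) = k * resolvent_const l f"
    using d by (auto simp: resolvent_const_def simp del: sphere_inverse.simps)
  have "resolvent_chart l (\<lambda>x. k * f x) u = k * resolvent_chart l f u" for u
    unfolding resolvent_chart_def c d
    by (simp add: mult.assoc right_diff_distrib[symmetric] del: sphere_inverse.simps)
  with c show ?thesis by (auto simp: resolvent_def fun_eq_iff split: option.splits)
qed

lemma resolvent_pointwise_bound:
  assumes p: "1 \<le> p"
  obtains A B where "0 \<le> A" "0 \<le> B"
    "\<And>g x. g \<in> bergman_space p \<Omega> \<Longrightarrow> x \<in> \<Omega> \<Longrightarrow>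
      cmod (resolvent \<Omega> l g x) \<le> A * cmod (g x) + B * bergman_norm p \<Omega> g"
proof -
  let ?U = "{u. sphere_inverse (Some u) \<in> \<Omega>}"
  have "l \<in> ?U" using l_chart by (rule CollectI)
  with open_chart_infinity[OF \<Omega>] obtain e where e: "0 < e" "cball l e \<subseteq> ?U"
    unfolding open_contains_cball by blast
  \<comment> \<open>The circle around l must avoid u = 0, because point evaluations are bounded on
    compact subsets of the plane and u = 0 is infinity. For l = 0 any radius does this; otherwise
    the radius stays below |l|.\<close>
  define \<rho> where "\<rho> = (if l = 0 then e else min e (cmod l / 2))"
  have \<rho>: "0 < \<rho>" "cball l \<rho> \<subseteq> ?U" "l \<noteq> 0 \<Longrightarrow> \<rho> < cmod l"
    using e by (auto simp: \<rho>_def subset_iff min_less_iff_disj simp del: sphere_inverse.simps)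
  have nz: "u \<noteq> 0" if "u \<in> sphere l \<rho>" for u
    using that \<rho>(1,3) by (cases "l = 0") auto
  define K where "K = (\<lambda>u. 1 / u) ` sphere l \<rho>"
  have "compact K" unfolding K_def
    using nz by (intro compact_continuous_image continuous_intros) auto
  moreover have "Some ` K \<subseteq> \<Omega>"
  proof -
    have "Some (1 / u) \<in> \<Omega>" if "u \<in> sphere l \<rho>" for u
    proof -
      have "u \<in> cball l \<rho>" using that by simp
      with \<rho>(2) have "u \<in> ?U" by (rule subsetD)
      then show ?thesis using nz[OF that] by simp
    qed
    then show ?thesis by (auto simp: K_def)
  qed
  ultimately obtain C where C: "0 \<le> C"
    "\<And>f a. f \<in> bergman_space p \<Omega> \<Longrightarrow> a \<in> K \<Longrightarrow> cmod (f (Some a)) \<le> C * bergman_norm p \<Omega> f"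
    using bergman_point_evaluation_bounded[OF \<Omega> p] by blast
  \<comment> \<open>If B bounds g on the circle, then B D bounds \<open>resolvent_const\<close>: by
    Cauchy's inequality for l = 0, by the maximum principle at l otherwise. Next, B E bounds the
    chart function on the disc, and B E' is the share of the constant outside it.\<close>
  define D where "D = (if l = 0 then 1 / \<rho> else 1 / cmod l)"
  define E where "E = (1 + D * (cmod l + \<rho>)) / \<rho>"
  define E' where "E' = D * (1 + cmod l / \<rho>)"
  have D0: "0 \<le> D" and E0: "0 \<le> E" "0 \<le> E'" using \<rho>(1) by (auto simp: D_def E_def E'_def)
  have "cmod (resolvent \<Omega> l g x) \<le> (1 / \<rho>) * cmod (g x) + (C * (E + E')) * bergman_norm p \<Omega> g"
    if g: "g \<in> bergman_space p \<Omega>" and x: "x \<in> \<Omega>" for g x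
  proof -
    define B where "B = C * bergman_norm p \<Omega> g"
    define G where "G = (\<lambda>u. g (sphere_inverse (Some u)))"
    let ?c = "resolvent_const l g"
    have B0: "0 \<le> B" using C(1) by (simp add: B_def bergman_norm_nonneg)
    have gh: "g \<in> holo_space \<Omega>" using g by (simp add: bergman_space_def)
    have holG: "G holomorphic_on cball l \<rho>"
      using holo_space_chart_infinity[OF gh] \<rho>(2) unfolding G_def by (rule holomorphic_on_subset)
    have GB: "cmod (G u) \<le> B" if "u \<in> sphere l \<rho>" for u
    proof -
      have "1 / u \<in> K" using that by (auto simp: K_def)
      from C(2)[OF g this] show ?thesis using nz[OF that] by (simp add: G_def B_def)
    qed
    have cB: "cmod ?c \<le> B * D"
    proof (cases "l = 0")
      case True
      have "cmod ((deriv ^^ 1) G l) \<le> fact 1 * B / \<rho> ^ 1"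
        by (rule Cauchy_inequality)
          (use holG GB \<rho>(1) in \<open>auto simp: dist_norm intro: holomorphic_on_imp_continuous_on holomorphic_on_subset\<close>)
      then show ?thesis using True by (simp add: resolvent_const_def G_def D_def)
    next
      case False
      have "cmod (G l) \<le> B"
        by (rule maximum_modulus_frontier[where f = G and S = "cball l \<rho>"])
          (use holG GB \<rho>(1) in \<open>auto intro: holomorphic_on_imp_continuous_on holomorphic_on_subset\<close>)
      then show ?thesis
        using False by (simp add: resolvent_const_def G_def D_def norm_divide divide_right_mono)
    qed
    have near: "cmod (resolvent_chart l g u) \<le> B * E" if "u \<in> cball l \<rho>" for u
    proof (rule maximum_modulus_frontier[where f = "resolvent_chart l g" and S = "cball l \<rho>"])
      have hol: "resolvent_chart l g holomorphic_on cball l \<rho>"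
        using resolvent_chart_holomorphic[OF gh] \<rho>(2) by (rule holomorphic_on_subset)
      then show "resolvent_chart l g holomorphic_on interior (cball l \<rho>)"
        using interior_subset by (rule holomorphic_on_subset)
      show "continuous_on (closure (cball l \<rho>)) (resolvent_chart l g)"
        using hol by (simp add: holomorphic_on_imp_continuous_on)
      fix w assume "w \<in> frontier (cball l \<rho>)"
      then have w: "w \<in> sphere l \<rho>" by simp
      then have wl: "w \<noteq> l" "cmod (w - l) = \<rho>" using \<rho>(1) by (auto simp: dist_norm norm_minus_commute)
      have "cmod w \<le> cmod l + \<rho>"
        using wl(2) norm_triangle_ineq[of l "w - l"] by simp
      then have "cmod (?c * w) \<le> (B * D) * (cmod l + \<rho>)"
        unfolding norm_mult using cB B0 D0 by (intro mult_mono) auto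
      then have "cmod (G w - ?c * w) \<le> B * (1 + D * (cmod l + \<rho>))"
        using GB[OF w] norm_triangle_ineq4[of "G w" "?c * w"] by (simp add: algebra_simps)
      moreover have "cmod (resolvent_chart l g w) = cmod (G w - ?c * w) / \<rho>"
        using wl by (simp add: resolvent_chart_def G_def norm_divide del: sphere_inverse.simps)
      ultimately show "cmod (resolvent_chart l g w) \<le> B * E"
        using \<rho>(1) by (simp add: E_def divide_right_mono)
    qed (use that in auto)
    have pos: "0 \<le> (1 / \<rho>) * cmod (g x)" "0 \<le> B * E" "0 \<le> B * E'"
      using \<rho>(1) B0 E0 by auto
    have "cmod (resolvent \<Omega> l g x) \<le> (1 / \<rho>) * cmod (g x) + (B * E + B * E')"
    proof (cases x)
      case None
      then show ?thesis using pos x resolvent_chart_zero[OF gh] by (simp add: resolvent_def)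
    next
      case (Some z)
      show ?thesis
      proof (cases "z \<noteq> 0 \<and> 1 / z \<in> cball l \<rho>")
        case True
        then have "cmod (resolvent \<Omega> l g x) \<le> B * E"
          using near[of "1 / z"] x by (simp add: Some resolvent_def del: mem_cball)
        then show ?thesis using pos by simp
      next
        case False
        have far: "z \<noteq> 0 \<Longrightarrow> \<rho> \<le> cmod (1 / z - l)"
          using False by (auto simp: dist_norm norm_minus_commute)
        note est = norm_one_minus_mult_ge[OF \<rho>(1) far]
        define M where "M = cmod (1 - l * z)"
        have M: "\<rho> * cmod z \<le> M" "1 \<le> M * (1 + cmod l / \<rho>)" using est by (auto simp: M_def)
        have M0: "0 < M" using M(2) by (cases "M = 0") (auto simp: M_def)
        have "cmod (resolvent \<Omega> l g x) * M = cmod (z * g x - ?c)"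
          using resolvent_mult[OF gh, of z] x by (simp add: Some M_def norm_mult[symmetric])
        also have "\<dots> \<le> cmod z * cmod (g x) + cmod ?c"
          by (metis norm_mult norm_triangle_ineq4)
        \<comment> \<open>Each term is made proportional to \<open>M\<close>, by absorbing |z| in
          the first and the factor 1 in the second, so that \<open>M\<close> cancels and no growth
          in z remains.\<close>
        also have "\<dots> \<le> (M / \<rho>) * cmod (g x) + (B * D) * (M * (1 + cmod l / \<rho>))"
        proof (intro add_mono mult_right_mono)
          show "cmod z \<le> M / \<rho>" using M(1) \<rho>(1) by (simp add: field_simps)
          have "cmod ?c \<le> (B * D) * 1" using cB by simp
          also have "\<dots> \<le> (B * D) * (M * (1 + cmod l / \<rho>))"
            using M(2) B0 D0 by (intro mult_left_mono) auto
          finally show "cmod ?c \<le> (B * D) * (M * (1 + cmod l / \<rho>))" .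
        qed simp
        also have "\<dots> = ((1 / \<rho>) * cmod (g x) + B * E') * M"
          by (simp add: E'_def algebra_simps)
        finally have "cmod (resolvent \<Omega> l g x) \<le> (1 / \<rho>) * cmod (g x) + B * E'"
          using M0 by simp
        then show ?thesis using pos by simp
      qed
    qed
    then show ?thesis by (simp add: B_def algebra_simps)
  qed
  then show ?thesis using that[of "1 / \<rho>" "C * (E + E')"] \<rho>(1) C(1) E0 by simp
qed

lemma not_in_spectrum:
  assumes p: "1 \<le> p"
  shows "l \<notin> taylor_spectrum p \<Omega>"
proof -
  let ?X = "bergman_space p \<Omega>" and ?N = "bergman_norm p \<Omega>"
  have X: "g \<in> holo_space \<Omega>" if "g \<in> ?X" for g using that by (simp add: bergman_space_def)
  obtain A B where AB: "0 \<le> A" "0 \<le> B"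
    "\<And>g x. g \<in> ?X \<Longrightarrow> x \<in> \<Omega> \<Longrightarrow> cmod (resolvent \<Omega> l g x) \<le> A * cmod (g x) + B * ?N g"
    by (rule resolvent_pointwise_bound[OF p]) blast
  obtain C where C: "\<And>f g. f \<in> holo_space \<Omega> \<Longrightarrow> g \<in> ?X \<Longrightarrow>
      (\<And>x. x \<in> \<Omega> \<Longrightarrow> cmod (f x) \<le> A * cmod (g x) + B * ?N g) \<Longrightarrow> f \<in> ?X \<and> ?N f \<le> C * ?N g"
    by (rule bergman_space_dominated[OF \<Omega> p AB(1,2)]) blast
  have R: "resolvent \<Omega> l g \<in> ?X \<and> ?N (resolvent \<Omega> l g) \<le> C * ?N g" if "g \<in> ?X" for g
    using C[OF resolvent_holo[OF X[OF that]] that AB(3)[OF that]] .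
  have "bounded_operator_on ?X ?N (resolvent \<Omega> l)"
    unfolding bounded_operator_on_def
  proof (intro conjI ballI allI)
    show "resolvent \<Omega> l f \<in> ?X" if "f \<in> ?X" for f using R[OF that] by simp
    show "resolvent \<Omega> l (\<lambda>x. f x + g x) = (\<lambda>x. resolvent \<Omega> l f x + resolvent \<Omega> l g x)"
      if "f \<in> ?X" "g \<in> ?X" for f g using resolvent_add[OF X[OF that(1)] X[OF that(2)]] .
    show "resolvent \<Omega> l (\<lambda>x. c * f x) = (\<lambda>x. c * resolvent \<Omega> l f x)"
      if "f \<in> ?X" for c f using resolvent_scale[OF X[OF that]] .
    show "\<exists>C. \<forall>f\<in>?X. ?N (resolvent \<Omega> l f) \<le> C * ?N f" using R by blast
  qed
  moreover have "\<forall>f\<in>?X. resolvent \<Omega> l (\<lambda>z. taylor_shift \<Omega> f z - l * f z) = f"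
    using resolvent_taylor_shift[OF X] by simp
  moreover have "\<forall>f\<in>?X. (\<lambda>z. taylor_shift \<Omega> (resolvent \<Omega> l f) z - l * resolvent \<Omega> l f z) = f"
    using taylor_shift_resolvent[OF X] by simp
  ultimately show ?thesis unfolding spectrum_on_def by blast
qed

end

theorem mainTheorem3:
  fixes \<Omega> :: "complex option set"
  assumes "openin riemann_sphere \<Omega>" and "Some 0 \<in> \<Omega>"
  shows "(\<forall>p::real. 1 \<le> p \<longrightarrow>
            interior (star \<Omega>) \<subseteq> taylor_point_spectrum p \<Omega> \<and>
            closure (interior (star \<Omega>)) \<subseteq> taylor_spectrum p \<Omega> \<and>
            taylor_spectrum p \<Omega> \<subseteq> star \<Omega>) \<and>
         (\<forall>p::real. 1 \<le> p \<and> p < 2 \<longrightarrow>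
            taylor_point_spectrum p \<Omega> = taylor_spectrum p \<Omega> \<and>
            taylor_spectrum p \<Omega> = star \<Omega>)"
proof (intro conjI allI impI)
  fix p :: real
  show upper: "taylor_spectrum p \<Omega> \<subseteq> star \<Omega>" if "1 \<le> p" for p
    using resolvent_point.not_in_spectrum[OF resolvent_point.intro[OF assms] that] by blast
  have point: "taylor_point_spectrum p \<Omega> \<subseteq> taylor_spectrum p \<Omega>"
    by (rule point_spectrum_subset_spectrum)
  show "interior (star \<Omega>) \<subseteq> taylor_point_spectrum p \<Omega>" if "1 \<le> p"
    using star_in_point_spectrum[OF assms] cauchy_kernel_bergman_interior[OF assms(1) _ that]
      interior_subset by blast
  show "closure (interior (star \<Omega>)) \<subseteq> taylor_spectrum p \<Omega>" if "1 \<le> p"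
    by (rule closure_interior_star_subset_spectrum[OF assms that])
  assume p: "1 \<le> p \<and> p < 2"
  then have "star \<Omega> \<subseteq> taylor_point_spectrum p \<Omega>"
    using star_in_point_spectrum[OF assms] cauchy_kernel_bergman[OF assms(1)] by blast
  \<comment> \<open>The chain from \<open>star \<Omega>\<close> through the point spectrum and the
    spectrum back to \<open>star \<Omega>\<close> closes up.\<close>
  with point upper p show "taylor_point_spectrum p \<Omega> = taylor_spectrum p \<Omega>"
    "taylor_spectrum p \<Omega> = star \<Omega>" by blast+
qed

end
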